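(* For every $\tau\in\mathbb{H}^2$ set $$x=x(\tau)=\frac{\eta^3(\tau)\,\eta^6(3\tau/2)\,\eta^3(6\tau)}{\eta^2(\tau/2)\,\eta(2\tau)\,\eta^9(3\tau)},\qquad Q(\tau)=\frac{\eta(\tau/2)\,\eta^6(3\tau)}{\eta^2(\tau)\,\eta^3(3\tau/2)} .$$ Then the inverse function $\tau=\tau(x)$ yields $Q(x)=Q(\tau(x))$, and $Q(x)$ satisfies the differential equation $$\frac{d^2Q}{dx^2}+\left\{\frac1x-\frac{1}{x-1}+\frac{1}{x+1}+\frac{1}{x-2}+\frac{1}{x-\frac12}\right\}\frac{dQ}{dx}+\frac{2\left(x^2-x+1\right)}{(x-1)^2(x+1)(2x-1)}\,Q=0 .$$
   Context: $\mathbb{H}^2=\{\tau\in\mathbb{C}\mid \Im\tau>0\}$; $\eta(\tau)=e^{2\pi i\tau/24}\prod_{n\ge1}(1-e^{2\pi i n\tau})$ is the Dedekind eta function and $\eta^k(r\tau)=(\eta(r\tau))^k$. The inverse function $\tau=\tau(x)$ means any local holomorphic inverse of $\tau\mapsto x(\tau)$; thus $Q$ is regarded locally as a function of the variable $x$. *)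

theory Defs
  imports "HOL-Complex_Analysis.Complex_Analysis"
begin

definition upper_half_plane :: "complex set" where
  "upper_half_plane = {\<tau>. Im \<tau> > 0}"

(* The product index is shifted: n :: nat starts at 0, so the n-th factor is
   1 - exp (2 pi i (n + 1) tau). The value is meaningful only for Im tau > 0. *)
definition dedekind_eta :: "complex \<Rightarrow> complex" where
  "dedekind_eta \<tau> = exp (2 * of_real pi * \<i> * \<tau> / 24) *
     (\<Prod>n. 1 - exp (2 * of_real pi * \<i> * of_nat (Suc n) * \<tau>))"

definition x_tau :: "complex \<Rightarrow> complex" where
  "x_tau \<tau> =
     (dedekind_eta \<tau> ^ 3 * dedekind_eta (3 * \<tau> / 2) ^ 6 * dedekind_eta (6 * \<tau>) ^ 3) /
     (dedekind_eta (\<tau> / 2) ^ 2 * dedekind_eta (2 * \<tau>) * dedekind_eta (3 * \<tau>) ^ 9)"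

definition Q_tau :: "complex \<Rightarrow> complex" where
  "Q_tau \<tau> =
     (dedekind_eta (\<tau> / 2) * dedekind_eta (3 * \<tau>) ^ 6) /
     (dedekind_eta \<tau> ^ 2 * dedekind_eta (3 * \<tau> / 2) ^ 3)"

(* T is a holomorphic branch, on the open set U, of the inverse of f restricted to D.
   The left inverse law T (f w) = w for w in T ` U follows from the last conjunct. *)
definition local_holomorphic_inverse ::
  "(complex \<Rightarrow> complex) \<Rightarrow> complex set \<Rightarrow> complex set \<Rightarrow> (complex \<Rightarrow> complex) \<Rightarrow> bool" where
  "local_holomorphic_inverse f D U T \<longleftrightarrow>
     open U \<and> T holomorphic_on U \<and> T ` U \<subseteq> D \<and> (\<forall>z\<in>U. f (T z) = z)"

end

theory Submission
  imports Defs
begin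

text \<open>
  Everything is expressed in the nome \<open>q = exp (\<pi> \<i> \<tau>)\<close>, which runs through the punctured unit
  disc; write \<open>D = q d/dq\<close>. In this variable both eta quotients are holomorphic on the whole disc,
  because the fractional powers of \<open>q\<close> combine to integral ones.

  Put \<open>a = \<theta>\<^sub>3(q)\<close>, \<open>b = \<theta>\<^sub>4(q) = \<theta>\<^sub>3(-q)\<close>, and \<open>A\<close>, \<open>B\<close> for the same functions at \<open>q\<^sup>3\<close>. Three groups of
  facts carry the proof.

  \<^item> Algebraic relations. Jacobi's triple product writes theta series as eta quotients. Rearranging
    double series gives the duplication formula \<open>a\<^sup>2 + b\<^sup>2 = 2 \<theta>\<^sub>3(q\<^sup>2)\<^sup>2\<close> and Legendre's cubic modular
    equation \<open>a A - b B = \<theta>\<^sub>2(q) \<theta>\<^sub>2(q\<^sup>3)\<close>, together with \<open>a^4 - b^4 = \<theta>\<^sub>2(q)^4\<close>. The eta quotient \<open>x\<close>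
    satisfies \<open>x\<^sup>2 b A\<^sup>3 = a B\<^sup>3\<close>; inserted into the fourth power of the modular equation, this leaves
    a product of two factors, one of which must vanish identically. The result is that \<open>B^4/A^4\<close> and
    \<open>b^4/a^4\<close> are explicit rational functions of \<open>x\<close>: \<open>x\<close> parametrizes the modular curve, and it
    avoids the values \<open>0, 1, -1, 2, 1/2\<close>.

  \<^item> Differential relations in level two. Let \<open>M = 2 D a / a\<close>. Then
    \<open>M(q) - M(-q) = (a^4 - b^4) / 2\<close> and \<open>D M = M\<^sup>2 + b^4 (a^4 - b^4) / 4\<close>. Usually these come from the
    theory of modular forms; here both follow from the duplication formulas alone: the quotient of the
    two sides of the first relation is invariant under \<open>q \<mapsto> q\<^sup>2\<close>, and the difference \<open>G\<close> of the two sides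
    of the second satisfies \<open>G(q) = 4 G(q\<^sup>2)\<close>. Iterating \<open>q \<mapsto> q\<^sup>2\<close> drives the argument to \<open>0\<close>, where the
    behaviour is known.

  \<^item> Combination. Differentiating the rational expressions for \<open>B^4/A^4\<close> and \<open>b^4/a^4\<close> with the first
    relation gives \<open>D x = P(x) A^4\<close> with \<open>P(x) = x (2 - x) (x\<^sup>2 - 1) / 2\<close>, and
    \<open>a^4 = (2 x - 1)\<^sup>2 A^4\<close>. Then \<open>Q^8\<close> is a rational function of \<open>x\<close> times \<open>A^16\<close>, so
    \<open>D Q / Q = m + W(x) A^4\<close> with \<open>m = 3 M(q\<^sup>3)\<close> and a rational function \<open>W\<close>. With \<open>t = m / A^4\<close> this reads
    \<open>dQ/dx = Q (t + W) / P\<close>, and the second relation becomes the Riccati equation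
    \<open>dt/dx = (c - t\<^sup>2) / P\<close> with \<open>c\<close> rational. Eliminating \<open>t\<close> from these two first order equations is
    rational function arithmetic and yields the differential equation. Only the eighth power of \<open>Q\<close> is
    used, so no branch of a root has to be chosen.
\<close>

section \<open>Euler's product\<close>

definition euler_prod :: "complex \<Rightarrow> complex" where
  "euler_prod q = (\<Prod>n. 1 - q ^ Suc n)"

lemma convergent_prod_one_plus_geometric:
  fixes q c :: complex
  assumes "norm q < 1"
  shows "convergent_prod (\<lambda>n. 1 + c * q ^ n)"
proof -
  have "summable (\<lambda>n. norm (c * q ^ n))"
    using assms by (auto simp: norm_mult norm_power intro!: summable_mult summable_geometric)
  then have "abs_convergent_prod (\<lambda>n. 1 + c * q ^ n)"
    by (simp add: abs_convergent_prod_conv_summable)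
  then show ?thesis
    by (rule abs_convergent_prod_imp_convergent_prod)
qed

lemma prod_one_plus_geometric_LIMSEQ:
  fixes q c :: complex
  assumes "norm q < 1"
  shows "(\<lambda>N. \<Prod>n<N. 1 + c * q ^ n) \<longlonglongrightarrow> (\<Prod>n. 1 + c * q ^ n)"
  using convergent_prod_LIMSEQ[OF convergent_prod_one_plus_geometric[OF assms, of c]]
  by (simp add: LIMSEQ_lessThan_iff_atMost)

lemma power_Suc_neq_1:
  fixes q :: complex
  assumes "norm q < 1"
  shows "q ^ Suc n \<noteq> 1"
proof
  assume "q ^ Suc n = 1"
  then have "norm q ^ Suc n = 1"
    by (metis norm_one norm_power)
  moreover have "norm q ^ Suc n < 1"
    using assms by (simp add: power_less_one_iff del: power_Suc)
  ultimately show False by simp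
qed

lemma euler_prod_LIMSEQ:
  assumes "norm q < 1"
  shows "(\<lambda>N. \<Prod>n<N. 1 - q ^ Suc n) \<longlonglongrightarrow> euler_prod q"
  using prod_one_plus_geometric_LIMSEQ[OF assms, of "-q"] by (simp add: euler_prod_def)

lemma euler_prod_nonzero:
  assumes "norm q < 1"
  shows "euler_prod q \<noteq> 0"
proof -
  have "convergent_prod (\<lambda>n. 1 - q ^ Suc n)"
    using convergent_prod_one_plus_geometric[OF assms, of "-q"] by simp
  then show ?thesis
    unfolding euler_prod_def by (rule prodinf_nonzero) (use power_Suc_neq_1[OF assms] in auto)
qed

lemma euler_prod_0 [simp]: "euler_prod 0 = 1"
  by (simp add: euler_prod_def)

text \<open>
  The partial products converge uniformly on every closed disc inside the unit disc: on such a disc some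
  point has maximal modulus, and the geometric series at that point is a Weierstrass majorant.
\<close>

lemma holomorphic_euler_prod: "euler_prod holomorphic_on ball 0 1"
proof (rule holomorphic_uniform_sequence)
  show "(\<lambda>q. \<Prod>n<N. 1 - q ^ Suc n) holomorphic_on ball 0 1" for N
    by (intro holomorphic_intros)
  fix q0 :: complex assume "q0 \<in> ball 0 1"
  then obtain d where d: "d > 0" "cball q0 d \<subseteq> ball 0 1"
    using open_contains_cball open_ball by blast
  have "compact (norm ` cball q0 d)"
    by (intro compact_continuous_image continuous_intros) auto
  then obtain x where x: "x \<in> cball q0 d" and xm: "\<And>y. y \<in> cball q0 d \<Longrightarrow> norm y \<le> norm x"
    using compact_attains_sup[of "norm ` cball q0 d"] d by auto
  have x1: "norm x < 1" using x d by auto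
  have "uniformly_convergent_on (cball q0 d) (\<lambda>N q. \<Sum>n<N. norm (1 - q ^ Suc n - 1))"
  proof (rule Weierstrass_m_test')
    fix n and q assume "q \<in> cball q0 d"
    then have "norm q ^ Suc n \<le> norm x ^ Suc n"
      by (intro power_mono xm) auto
    then show "norm (norm (1 - q ^ Suc n - 1)) \<le> norm x ^ Suc n"
      by (simp add: norm_mult norm_power)
  next
    show "summable (\<lambda>n. norm x ^ Suc n)"
      using x1 summable_Suc_iff[of "\<lambda>n. norm x ^ n"] by (simp add: summable_geometric)
  qed
  then have "uniformly_convergent_on (cball q0 d) (\<lambda>N q. \<Prod>n<N. 1 - q ^ Suc n)"
    by (intro uniformly_convergent_on_prod' continuous_intros) auto
  then have "uniform_limit (cball q0 d) (\<lambda>N q. \<Prod>n<N. 1 - q ^ Suc n)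
      (\<lambda>q. lim (\<lambda>N. \<Prod>n<N. 1 - q ^ Suc n)) sequentially"
    by (simp add: uniformly_convergent_uniform_limit_iff)
  moreover have "lim (\<lambda>N. \<Prod>n<N. 1 - q ^ Suc n) = euler_prod q" if "q \<in> cball q0 d" for q
    using euler_prod_LIMSEQ[of q] that d by (auto intro!: limI)
  ultimately have "uniform_limit (cball q0 d) (\<lambda>N q. \<Prod>n<N. 1 - q ^ Suc n) euler_prod sequentially"
    by (metis (mono_tags, lifting) uniform_limit_cong')
  then show "\<exists>d>0. cball q0 d \<subseteq> ball 0 1 \<and>
      uniform_limit (cball q0 d) (\<lambda>N q. \<Prod>n<N. 1 - q ^ Suc n) euler_prod sequentially"
    using d by blast
qed auto

lemma norm_power_less_1: "norm (q :: complex) < 1 \<Longrightarrow> k > 0 \<Longrightarrow> norm (q ^ k) < 1"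
  by (simp add: norm_power power_less_one_iff)

lemma norm_power2_less_1: "norm (q :: complex) < 1 \<Longrightarrow> norm (q\<^sup>2) < 1"
  by (rule norm_power_less_1) auto

definition odd_prod :: "complex \<Rightarrow> complex" where
  "odd_prod q = (\<Prod>n. 1 - q ^ (2 * n + 1))"

lemma odd_prod_LIMSEQ:
  assumes "norm q < 1"
  shows "(\<lambda>N. \<Prod>n<N. 1 - q ^ (2 * n + 1)) \<longlonglongrightarrow> odd_prod q"
  using prod_one_plus_geometric_LIMSEQ[OF norm_power2_less_1[OF assms], of "-q"]
  by (simp add: odd_prod_def power_mult)

lemma euler_prod_split:
  assumes "norm q < 1"
  shows "euler_prod q = odd_prod q * euler_prod (q\<^sup>2)"
proof (rule LIMSEQ_unique)
  have "strict_mono (\<lambda>N::nat. 2 * N)" by (auto simp: strict_mono_def)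
  from LIMSEQ_subseq_LIMSEQ[OF euler_prod_LIMSEQ[OF assms] this]
  show "(\<lambda>N. \<Prod>n<2 * N. 1 - q ^ Suc n) \<longlonglongrightarrow> euler_prod q"
    by (simp add: o_def)
  have "(\<Prod>n<2 * N. 1 - q ^ Suc n)
      = (\<Prod>n<N. 1 - q ^ (2 * n + 1)) * (\<Prod>n<N. 1 - (q\<^sup>2) ^ Suc n)" for N
    by (induction N) (simp_all add: power_mult[symmetric] algebra_simps del: power_Suc)
  then show "(\<lambda>N. \<Prod>n<2 * N. 1 - q ^ Suc n) \<longlonglongrightarrow> odd_prod q * euler_prod (q\<^sup>2)"
    using tendsto_mult[OF odd_prod_LIMSEQ[OF assms] euler_prod_LIMSEQ[OF norm_power2_less_1[OF assms]]]
    by simp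
qed

lemma odd_prod_uminus:
  assumes "norm q < 1"
  shows "odd_prod q * odd_prod (-q) = odd_prod (q\<^sup>2)"
proof (rule LIMSEQ_unique)
  show "(\<lambda>N. (\<Prod>n<N. 1 - q ^ (2 * n + 1)) * (\<Prod>n<N. 1 - (-q) ^ (2 * n + 1)))
      \<longlonglongrightarrow> odd_prod q * odd_prod (-q)"
    by (intro tendsto_mult odd_prod_LIMSEQ) (use assms in auto)
  have "(1 - q ^ (2 * n + 1)) * (1 - (-q) ^ (2 * n + 1)) = 1 - (q\<^sup>2) ^ (2 * n + 1)" for n
  proof -
    have "(-q) ^ (2 * n + 1) = - (q ^ (2 * n + 1))" by simp
    moreover have "(q\<^sup>2) ^ (2 * n + 1) = (q ^ (2 * n + 1))\<^sup>2"
      by (simp only: power_mult[symmetric] mult.commute)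
    moreover have "(1 - x) * (1 - (- x)) = 1 - x\<^sup>2" for x :: complex
      by algebra
    ultimately show ?thesis by presburger
  qed
  then have "(\<Prod>n<N. 1 - q ^ (2 * n + 1)) * (\<Prod>n<N. 1 - (-q) ^ (2 * n + 1))
      = (\<Prod>n<N. 1 - (q\<^sup>2) ^ (2 * n + 1))" for N
    unfolding prod.distrib[symmetric] by (intro prod.cong refl)
  then show "(\<lambda>N. (\<Prod>n<N. 1 - q ^ (2 * n + 1)) * (\<Prod>n<N. 1 - (-q) ^ (2 * n + 1)))
      \<longlonglongrightarrow> odd_prod (q\<^sup>2)"
    using odd_prod_LIMSEQ[OF norm_power2_less_1[OF assms]] by simp
qed

text \<open>
  The odd-indexed factors at \<open>q\<close> and \<open>-q\<close> multiply to those at \<open>q\<^sup>2\<close>. This is the identity behind every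
  relation between eta quotients below.
\<close>

lemma euler_prod_uminus:
  assumes "norm q < 1"
  shows "euler_prod q * euler_prod (-q) * euler_prod (q ^ 4) = euler_prod (q\<^sup>2) ^ 3"
proof -
  have q2: "norm (q\<^sup>2) < 1" by (rule norm_power2_less_1[OF assms])
  have "euler_prod q * euler_prod (-q) = odd_prod q * odd_prod (-q) * euler_prod (q\<^sup>2) ^ 2"
    using euler_prod_split[OF assms] euler_prod_split[of "-q"] assms
    by (simp add: power2_eq_square)
  also have "odd_prod q * odd_prod (-q) = odd_prod (q\<^sup>2)"
    by (rule odd_prod_uminus[OF assms])
  finally have "euler_prod q * euler_prod (-q) = odd_prod (q\<^sup>2) * (euler_prod (q\<^sup>2))\<^sup>2" .
  moreover have "(q\<^sup>2)\<^sup>2 = q ^ 4" by (simp flip: power_mult)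
  ultimately show ?thesis
    using euler_prod_split[OF q2] by (simp add: power3_eq_cube power2_eq_square mult_ac)
qed

section \<open>Jacobi's triple product\<close>

definition q_fact :: "complex \<Rightarrow> nat \<Rightarrow> complex" where
  "q_fact Q n = (\<Prod>k<n. 1 - Q ^ Suc k)"

text \<open>
  The reciprocal of a q-factorial, extended by zero to negative arguments. With this convention its
  recurrence holds for all integers, so the q-binomial coefficients need no boundary cases.
\<close>

definition inv_q_fact :: "complex \<Rightarrow> int \<Rightarrow> complex" where
  "inv_q_fact Q m = (if m < 0 then 0 else 1 / q_fact Q (nat m))"

lemma inv_q_fact_step:
  assumes "norm Q < 1"
  shows "inv_q_fact Q m = (1 - Q powi (m + 1)) * inv_q_fact Q (m + 1)"
proof -
  consider "m < -1" | "m = -1" | "m \<ge> 0" by linarith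
  then show ?thesis
  proof cases
    case 3
    then have n: "nat (m + 1) = Suc (nat m)" by simp
    have "Q powi (m + 1) = Q ^ Suc (nat m)"
      using 3 n by (simp add: power_int_def)
    moreover have "1 - Q ^ Suc (nat m) \<noteq> 0"
      using power_Suc_neq_1[OF assms] by auto
    ultimately show ?thesis
      using 3 n by (simp add: inv_q_fact_def q_fact_def del: power_Suc)
  qed (auto simp: inv_q_fact_def)
qed

lemma q_fact_LIMSEQ:
  assumes "norm Q < 1"
  shows "q_fact Q \<longlonglongrightarrow> euler_prod Q"
  using euler_prod_LIMSEQ[OF assms] by (simp add: q_fact_def[abs_def])

text \<open>
  Gauss' finite form of the triple product: the coefficients are q-binomial coefficients
  \<open>[2N choose N + j]\<close> to the base \<open>q\<^sup>2\<close>. In the induction the two new factors multiply a coefficient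
  sequence by \<open>1 + t\<^sup>2 + t z + t / z\<close> with \<open>t = q^(2N + 1)\<close>, which shifts indices by one in both directions.
  Stating the result with \<open>has_sum\<close> over all integers makes these shifts plain reindexing.
\<close>

lemma finite_triple_product:
  fixes q z :: complex
  assumes q: "norm q < 1" "q \<noteq> 0" and z: "z \<noteq> 0"
  shows "((\<lambda>j. q_fact (q\<^sup>2) (2 * N) * inv_q_fact (q\<^sup>2) (int N + j) * inv_q_fact (q\<^sup>2) (int N - j)
            * q powi (j\<^sup>2) * z powi j) has_sum
          (\<Prod>k<N. (1 + q ^ (2 * k + 1) * z) * (1 + q ^ (2 * k + 1) / z))) UNIV"
proof (induction N)
  case 0
  have "((\<lambda>j. q_fact (q\<^sup>2) (2 * 0) * inv_q_fact (q\<^sup>2) (int 0 + j) * inv_q_fact (q\<^sup>2) (int 0 - j)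
            * q powi (j\<^sup>2) * z powi j) has_sum 1) {0}"
    by (rule has_sum_finiteI) (auto simp: inv_q_fact_def q_fact_def)
  also have "?this \<longleftrightarrow> ?case"
    by (simp, rule has_sum_cong_neutral) (auto simp: inv_q_fact_def)
  finally show ?case .
next
  case (Suc N)
  let ?Q = "q\<^sup>2"
  let ?c = "\<lambda>j. q_fact ?Q (2 * N) * inv_q_fact ?Q (int N + j) * inv_q_fact ?Q (int N - j) * q powi (j\<^sup>2) * z powi j"
  let ?p = "\<Prod>k<N. (1 + q ^ (2 * k + 1) * z) * (1 + q ^ (2 * k + 1) / z)"
  have Q1: "norm ?Q < 1" by (rule norm_power2_less_1[OF q(1)])
  have up: "((\<lambda>j. ?c (j - 1)) has_sum ?p) UNIV"
    using has_sum_reindex_bij_witness[of UNIV "\<lambda>j. j + 1" "\<lambda>j. j - 1" UNIV ?c] Suc.IH by simp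
  have dn: "((\<lambda>j. ?c (j + 1)) has_sum ?p) UNIV"
    using has_sum_reindex_bij_witness[of UNIV "\<lambda>j. j - 1" "\<lambda>j. j + 1" UNIV ?c] Suc.IH by simp
  let ?t = "q ^ (2 * N + 1)"
  have sum: "((\<lambda>j. (1 + ?t\<^sup>2) * ?c j + ?t * z * ?c (j - 1) + ?t / z * ?c (j + 1)) has_sum
      ((1 + ?t\<^sup>2) * ?p + ?t * z * ?p + ?t / z * ?p)) UNIV"
    by (intro has_sum_add has_sum_cmult_right Suc.IH up dn)
  have eq: "(1 + ?t\<^sup>2) * ?c j + ?t * z * ?c (j - 1) + ?t / z * ?c (j + 1)
      = q_fact ?Q (2 * Suc N) * inv_q_fact ?Q (int (Suc N) + j) * inv_q_fact ?Q (int (Suc N) - j)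
          * q powi (j\<^sup>2) * z powi j" for j
  proof -
    \<comment> \<open>In terms of the two new q-factorial factors \<open>1 - u\<close> and \<open>1 - v\<close> the recurrence becomes a polynomial identity.\<close>
    define u where "u = q powi (2 * int N + 2 + 2 * j)"
    define v where "v = q powi (2 * int N + 2 - 2 * j)"
    define R where "R = inv_q_fact ?Q (int N + j + 1)"
    define S where "S = inv_q_fact ?Q (int N - j + 1)"
    have Qpow: "?Q powi m = q powi (2 * m)" for m
      by (simp add: power_int_mult)
    have r1: "inv_q_fact ?Q (int N + j) = (1 - u) * R"
      using inv_q_fact_step[OF Q1, of "int N + j"] unfolding Qpow u_def R_def
      by (simp add: algebra_simps)
    have s1: "inv_q_fact ?Q (int N - j) = (1 - v) * S"
      using inv_q_fact_step[OF Q1, of "int N - j"] unfolding Qpow v_def S_def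
      by (simp add: algebra_simps)
    have "q powi (2 * (int N + j)) = u / q\<^sup>2"
      using q(2) power_int_diff[of q "2 * int N + 2 + 2 * j" 2] by (simp add: u_def algebra_simps)
    then have r2: "inv_q_fact ?Q (int N + (j - 1)) = (1 - u / q\<^sup>2) * ((1 - u) * R)"
      using inv_q_fact_step[OF Q1, of "int N + (j - 1)"] r1 unfolding Qpow
      by (metis (no_types, lifting) add_diff_eq diff_add_cancel)
    have "q powi (2 * (int N - j)) = v / q\<^sup>2"
      using q(2) power_int_diff[of q "2 * int N + 2 - 2 * j" 2] by (simp add: v_def algebra_simps)
    then have s2: "inv_q_fact ?Q (int N - (j + 1)) = (1 - v / q\<^sup>2) * ((1 - v) * S)"
      using inv_q_fact_step[OF Q1, of "int N - (j + 1)"] s1 unfolding Qpow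
      by (metis (no_types, lifting) diff_add_cancel diff_diff_eq)
    have r3: "inv_q_fact ?Q (int N + (j + 1)) = R" "inv_q_fact ?Q (int N - (j - 1)) = S"
      by (simp_all add: R_def S_def algebra_simps)
    have t: "?t = q powi (2 * int N + 1)"
      by (metis (mono_tags) of_nat_1 of_nat_add of_nat_mult of_nat_numeral power_int_of_nat)
    have q1: "?t * q powi ((j - 1)\<^sup>2) = q powi (j\<^sup>2) * v"
      unfolding t v_def using q(2)
      by (simp add: power_int_add[symmetric] power2_eq_square algebra_simps)
    have q2: "?t * q powi ((j + 1)\<^sup>2) = q powi (j\<^sup>2) * u"
      unfolding t u_def using q(2)
      by (simp add: power_int_add[symmetric] power2_eq_square algebra_simps)
    have zz: "z * z powi (j - 1) = z powi j" "z powi (j + 1) / z = z powi j"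
      using z by (simp_all add: power_int_add power_int_diff)
    have uv: "?t\<^sup>2 = u * v / q\<^sup>2"
    proof -
      have "u * v = q powi ((2 * int N + 1) + (2 * int N + 1) + 2)"
        using q(2) by (simp add: u_def v_def power_int_add[symmetric] add.commute)
      also have "\<dots> = ?t * ?t * q\<^sup>2"
        unfolding t using q(2) by (subst power_int_add, simp)+ simp
      finally show ?thesis using q(2) by (simp add: power2_eq_square)
    qed
    have qs: "q_fact ?Q (2 * Suc N) = q_fact ?Q (2 * N) * (1 - u * v / q\<^sup>2) * (1 - u * v)"
    proof -
      have "?Q ^ Suc (2 * N) = u * v / q\<^sup>2"
        unfolding uv[symmetric] by (simp flip: power_mult add: algebra_simps)
      moreover have "?Q ^ Suc (Suc (2 * N)) = u * v"
      proof -
        have "?Q ^ Suc (Suc (2 * N)) = ?Q * ?Q ^ Suc (2 * N)" by simp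
        also have "\<dots> = u * v"
          using q(2) by (subst \<open>?Q ^ Suc (2 * N) = u * v / q\<^sup>2\<close>) simp
        finally show ?thesis .
      qed
      ultimately show ?thesis
        by (simp add: q_fact_def del: power_Suc)
    qed
    have Rs: "inv_q_fact ?Q (int (Suc N) + j) = R" "inv_q_fact ?Q (int (Suc N) - j) = S"
      by (simp_all add: R_def S_def algebra_simps)
    have L: "(1 + ?t\<^sup>2) * ?c j = (1 + u * v / q\<^sup>2) * (1 - u) * (1 - v)
          * (q_fact ?Q (2 * N) * R * S * q powi (j\<^sup>2) * z powi j)"
      and U: "?t * z * ?c (j - 1) = v * (1 - u / q\<^sup>2) * (1 - u)
          * (q_fact ?Q (2 * N) * R * S * q powi (j\<^sup>2) * z powi j)"
      and D: "?t / z * ?c (j + 1) = u * (1 - v / q\<^sup>2) * (1 - v)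
          * (q_fact ?Q (2 * N) * R * S * q powi (j\<^sup>2) * z powi j)"
      and F: "q_fact ?Q (2 * Suc N) * inv_q_fact ?Q (int (Suc N) + j) * inv_q_fact ?Q (int (Suc N) - j)
          * q powi (j\<^sup>2) * z powi j = (1 - u * v / q\<^sup>2) * (1 - u * v)
          * (q_fact ?Q (2 * N) * R * S * q powi (j\<^sup>2) * z powi j)"
    proof -
      show "(1 + ?t\<^sup>2) * ?c j = (1 + u * v / q\<^sup>2) * (1 - u) * (1 - v)
          * (q_fact ?Q (2 * N) * R * S * q powi (j\<^sup>2) * z powi j)"
        unfolding r1 s1 uv by (simp only: mult_ac)
      have "?t * z * ?c (j - 1) = (?t * q powi ((j - 1)\<^sup>2)) * (z * z powi (j - 1))
          * q_fact ?Q (2 * N) * inv_q_fact ?Q (int N + (j - 1)) * inv_q_fact ?Q (int N - (j - 1))"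
        by (simp only: mult_ac)
      then show "?t * z * ?c (j - 1) = v * (1 - u / q\<^sup>2) * (1 - u)
          * (q_fact ?Q (2 * N) * R * S * q powi (j\<^sup>2) * z powi j)"
        unfolding q1 zz r2 r3 by (simp only: mult_ac)
      have "?t / z * ?c (j + 1) = (?t * q powi ((j + 1)\<^sup>2)) * (z powi (j + 1) / z)
          * q_fact ?Q (2 * N) * inv_q_fact ?Q (int N + (j + 1)) * inv_q_fact ?Q (int N - (j + 1))"
        by (simp add: mult_ac)
      then show "?t / z * ?c (j + 1) = u * (1 - v / q\<^sup>2) * (1 - v)
          * (q_fact ?Q (2 * N) * R * S * q powi (j\<^sup>2) * z powi j)"
        unfolding q2 zz s2 r3 by (simp only: mult_ac)
      show "q_fact ?Q (2 * Suc N) * inv_q_fact ?Q (int (Suc N) + j) * inv_q_fact ?Q (int (Suc N) - j)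
          * q powi (j\<^sup>2) * z powi j = (1 - u * v / q\<^sup>2) * (1 - u * v)
          * (q_fact ?Q (2 * N) * R * S * q powi (j\<^sup>2) * z powi j)"
        unfolding qs Rs by (simp only: mult_ac)
    qed
    have alg: "(1 + u * v * s) * (1 - u) * (1 - v) + v * (1 - u * s) * (1 - u) + u * (1 - v * s) * (1 - v)
        = (1 - u * v * s) * (1 - u * v)" for s by algebra
    show ?thesis
      unfolding L U D F distrib_right[symmetric]
      using alg[of "1 / q\<^sup>2"] by simp
  qed
  have "(1 + ?t\<^sup>2) * ?p + ?t * z * ?p + ?t / z * ?p = ?p * ((1 + ?t * z) * (1 + ?t / z))"
    using z by (simp add: field_simps power2_eq_square)
  with sum show ?case
    unfolding eq by (simp add: prod.lessThan_Suc del: power_Suc)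
qed

text \<open>
  Dominated convergence for unordered sums, read off from the theorem for the counting measure.
\<close>

lemma infsum_dominated_convergence:
  fixes f :: "nat \<Rightarrow> 'a \<Rightarrow> complex"
  assumes lim: "\<And>k. (\<lambda>n. f n k) \<longlonglongrightarrow> g k"
    and bound: "\<And>n k. norm (f n k) \<le> B k"
    and B: "B summable_on UNIV"
  shows "(\<lambda>n. infsum (f n) UNIV) \<longlonglongrightarrow> infsum g UNIV" "g summable_on UNIV"
proof -
  have gB: "norm (g k) \<le> B k" for k
    using tendsto_norm[OF lim[of k]] bound by (intro LIMSEQ_le_const2[of _ "norm (g k)"]) auto
  have fs: "(\<lambda>k. norm (f n k)) summable_on UNIV" for n
    by (rule Infinite_Sum.abs_summable_on_comparison_test'[OF B]) (use bound in auto)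
  have gs: "(\<lambda>k. norm (g k)) summable_on UNIV"
    by (rule Infinite_Sum.abs_summable_on_comparison_test'[OF B]) (use gB in auto)
  then show "g summable_on UNIV" by (rule abs_summable_summable)
  have Bn: "\<bar>B k\<bar> = B k" for k
    using gB[of k] norm_ge_zero[of "g k"] by (simp del: norm_ge_zero)
  have "integrable (count_space UNIV) B"
    using B abs_summable_equivalent[of B UNIV] unfolding abs_summable_on_def by (simp add: Bn)
  then have "(\<lambda>n. integral\<^sup>L (count_space UNIV) (f n)) \<longlonglongrightarrow> integral\<^sup>L (count_space UNIV) g"
    by (intro integral_dominated_convergence[where w = B]) (use lim bound in auto)
  moreover have "integral\<^sup>L (count_space UNIV) h = infsum h UNIV"
    if "(\<lambda>k. norm (h k)) summable_on UNIV" for h :: "'a \<Rightarrow> complex"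
    using infsetsum_infsum[of h UNIV] that abs_summable_equivalent[of h UNIV]
    by (simp add: infsetsum_def)
  ultimately show "(\<lambda>n. infsum (f n) UNIV) \<longlonglongrightarrow> infsum g UNIV"
    using fs gs by simp
qed

lemma summable_on_int_halves:
  fixes f :: "int \<Rightarrow> real"
  assumes "(\<lambda>n::nat. f (int n)) summable_on UNIV" "(\<lambda>n::nat. f (- int n)) summable_on UNIV"
  shows "f summable_on UNIV"
proof -
  have "f summable_on (range int)"
    using assms(1) by (subst summable_on_reindex) (auto simp: o_def)
  moreover have "f summable_on (range (\<lambda>n. - int n))"
    using assms(2) by (subst summable_on_reindex) (auto simp: o_def inj_on_def)
  ultimately have "f summable_on (range int \<union> (range (\<lambda>n. - int n) - range int))"
    by (intro summable_on_Un_disjoint) (auto intro: summable_on_subset_banach)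
  moreover have "range int \<union> (range (\<lambda>n. - int n) - range int) = UNIV"
    by (auto simp: image_iff) (metis int_cases2)
  ultimately show ?thesis by simp
qed

text \<open>
  The term is the \<open>n\<close>-th power of \<open>r^n w\<close>, which is eventually below one half.
\<close>

lemma summable_theta_nat:
  fixes r w :: real
  assumes "0 \<le> r" "r < 1" "0 \<le> w"
  shows "summable (\<lambda>n. r ^ (n\<^sup>2) * w ^ n)"
proof (rule summable_comparison_test_ev)
  have "(\<lambda>n. r ^ n * w) \<longlonglongrightarrow> 0 * w"
    using assms by (intro tendsto_intros LIMSEQ_realpow_zero) auto
  then have "eventually (\<lambda>n. r ^ n * w < 1 / 2) sequentially"
    by (rule order_tendstoD) auto
  then show "eventually (\<lambda>n. norm (r ^ (n\<^sup>2) * w ^ n) \<le> (1 / 2) ^ n) sequentially"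
  proof eventually_elim
    case (elim n)
    have "norm (r ^ (n\<^sup>2) * w ^ n) = (r ^ n * w) ^ n"
      using assms by (simp add: power_mult_distrib power2_eq_square power_mult)
    also have "\<dots> \<le> (1 / 2) ^ n"
      using elim assms by (intro power_mono) auto
    finally show ?case .
  qed
qed (simp add: summable_geometric)

lemma theta_summable_real:
  fixes r w :: real
  assumes "0 < r" "r < 1" "0 < w"
  shows "(\<lambda>j::int. r powi (j\<^sup>2) * w powi j) summable_on UNIV"
proof (rule summable_on_int_halves)
  have sq: "r powi ((int n)\<^sup>2) = r ^ (n\<^sup>2)" for n
    by (metis of_nat_power power_int_of_nat)
  show "(\<lambda>n. r powi ((int n)\<^sup>2) * w powi int n) summable_on UNIV"
    unfolding sq using summable_theta_nat[of r w] assms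
    by (intro summable_nonneg_imp_summable_on) auto
  have "(\<lambda>n. r ^ (n\<^sup>2) * (1 / w) ^ n) summable_on UNIV"
    using summable_theta_nat[of r "1 / w"] assms
    by (intro summable_nonneg_imp_summable_on) auto
  then show "(\<lambda>n. r powi ((- int n)\<^sup>2) * w powi (- int n)) summable_on UNIV"
    by (simp add: sq power_int_minus power_divide inverse_eq_divide)
qed

text \<open>
  The limit of the finite form. The q-factorials converge to a non-zero limit, hence they and their
  reciprocals are bounded, and a multiple of the theta series itself serves as majorant.
\<close>

theorem jacobi_triple_product:
  fixes q z :: complex
  assumes q: "norm q < 1" "q \<noteq> 0" and z: "z \<noteq> 0"
  shows "((\<lambda>j. q powi (j\<^sup>2) * z powi j) has_sum
      (euler_prod (q\<^sup>2) * (\<Prod>n. 1 + q ^ (2 * n + 1) * z) * (\<Prod>n. 1 + q ^ (2 * n + 1) / z))) UNIV"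
proof -
  let ?Q = "q\<^sup>2"
  let ?f = "\<lambda>N j. q_fact ?Q (2 * N) * inv_q_fact ?Q (int N + j) * inv_q_fact ?Q (int N - j) * q powi (j\<^sup>2) * z powi j"
  let ?g = "\<lambda>j. euler_prod ?Q * (1 / euler_prod ?Q) * (1 / euler_prod ?Q) * q powi (j\<^sup>2) * z powi j"
  have Q1: "norm ?Q < 1" by (rule norm_power2_less_1[OF q(1)])
  have E0: "euler_prod ?Q \<noteq> 0" by (rule euler_prod_nonzero[OF Q1])
  have P: "q_fact ?Q \<longlonglongrightarrow> euler_prod ?Q" by (rule q_fact_LIMSEQ[OF Q1])
  then have iP: "(\<lambda>n. 1 / q_fact ?Q n) \<longlonglongrightarrow> 1 / euler_prod ?Q"
    by (intro tendsto_divide tendsto_const E0)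
  obtain K where K: "K > 0" "\<And>n. norm (q_fact ?Q n) \<le> K"
    using convergent_imp_Bseq[OF convergentI[OF P]] unfolding Bseq_def by auto
  obtain L where L: "L > 0" "\<And>n. norm (1 / q_fact ?Q n) \<le> L"
    using convergent_imp_Bseq[OF convergentI[OF iP]] unfolding Bseq_def by auto
  have R: "norm (inv_q_fact ?Q m) \<le> L" for m
    using L by (auto simp: inv_q_fact_def)
  have Rlim: "(\<lambda>N. inv_q_fact ?Q (m N)) \<longlonglongrightarrow> 1 / euler_prod ?Q"
    if m: "filterlim (\<lambda>N. nat (m N)) at_top sequentially"
      and ev: "eventually (\<lambda>N. m N \<ge> 0) sequentially" for m :: "nat \<Rightarrow> int"
  proof -
    have "(\<lambda>N. 1 / q_fact ?Q (nat (m N))) \<longlonglongrightarrow> 1 / euler_prod ?Q"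
      by (rule filterlim_compose[OF iP m])
    then show ?thesis
      by (rule Lim_transform_eventually) (rule eventually_mono[OF ev], simp add: inv_q_fact_def)
  qed
  have Rl: "(\<lambda>N. inv_q_fact ?Q (int N + j)) \<longlonglongrightarrow> 1 / euler_prod ?Q" for j
  proof (rule Rlim)
    show "filterlim (\<lambda>N. nat (int N + j)) at_top sequentially"
      unfolding filterlim_at_top eventually_sequentially
    proof
      fix Z show "\<exists>N. \<forall>n\<ge>N. Z \<le> nat (int n + j)"
        by (rule exI[of _ "Z + nat \<bar>j\<bar>"]) auto
    qed
    show "eventually (\<lambda>N. int N + j \<ge> 0) sequentially"
      unfolding eventually_sequentially by (rule exI[of _ "nat \<bar>j\<bar>"]) auto
  qed
  have lim: "(\<lambda>N. ?f N j) \<longlonglongrightarrow> ?g j" for j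
  proof -
    have "strict_mono (\<lambda>N::nat. 2 * N)" by (auto simp: strict_mono_def)
    from LIMSEQ_subseq_LIMSEQ[OF P this] have "(\<lambda>N. q_fact ?Q (2 * N)) \<longlonglongrightarrow> euler_prod ?Q"
      by (simp add: o_def)
    then show ?thesis
      using Rl[of j] Rl[of "-j"] by (intro tendsto_intros) simp_all
  qed
  have bound: "norm (?f N j) \<le> K * L * L * (norm q powi (j\<^sup>2) * norm z powi j)" for N j
  proof -
    have "norm (?f N j) = norm (q_fact ?Q (2 * N)) * norm (inv_q_fact ?Q (int N + j)) * norm (inv_q_fact ?Q (int N - j))
        * (norm q powi (j\<^sup>2) * norm z powi j)"
      by (simp add: norm_mult norm_power_int)
    also have "\<dots> \<le> K * L * L * (norm q powi (j\<^sup>2) * norm z powi j)"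
      by (intro mult_right_mono mult_mono K R) (use K L in auto)
    finally show ?thesis .
  qed
  have B: "(\<lambda>j. K * L * L * (norm q powi (j\<^sup>2) * norm z powi j)) summable_on UNIV"
    using q z by (intro summable_on_cmult_right theta_summable_real) auto
  note dc = infsum_dominated_convergence[of ?f ?g, OF lim bound B]
  have pr: "(\<lambda>N. \<Prod>k<N. 1 + q ^ (2 * k + 1) * w) \<longlonglongrightarrow> (\<Prod>k. 1 + q ^ (2 * k + 1) * w)" for w
  proof -
    have "q ^ (2 * k + 1) = ?Q ^ k * q" for k
      by (simp only: power_add power_mult power_one_right)
    then have "q ^ (2 * k + 1) * w = q * w * ?Q ^ k" for k
      by (simp only: mult_ac)
    then show ?thesis
      using prod_one_plus_geometric_LIMSEQ[OF Q1, of "q * w"] by presburger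
  qed
  have "(\<lambda>N. (\<Prod>k<N. 1 + q ^ (2 * k + 1) * z) * (\<Prod>k<N. 1 + q ^ (2 * k + 1) * (1 / z)))
      \<longlonglongrightarrow> (\<Prod>n. 1 + q ^ (2 * n + 1) * z) * (\<Prod>n. 1 + q ^ (2 * n + 1) * (1 / z))"
    by (intro tendsto_mult pr)
  moreover have "infsum (?f N) UNIV
      = (\<Prod>k<N. 1 + q ^ (2 * k + 1) * z) * (\<Prod>k<N. 1 + q ^ (2 * k + 1) * (1 / z))" for N
    using infsumI[OF finite_triple_product[OF q z, of N]] by (simp add: prod.distrib)
  ultimately have eq: "infsum ?g UNIV
      = (\<Prod>n. 1 + q ^ (2 * n + 1) * z) * (\<Prod>n. 1 + q ^ (2 * n + 1) / z)"
    using LIMSEQ_unique[OF dc(1)] by simp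
  have "(?g has_sum (\<Prod>n. 1 + q ^ (2 * n + 1) * z) * (\<Prod>n. 1 + q ^ (2 * n + 1) / z)) UNIV"
    unfolding eq[symmetric] by (rule has_sum_infsum[OF dc(2)])
  from has_sum_cmult_right[OF this, of "euler_prod ?Q"] show ?thesis
    using E0 by (simp add: mult_ac)
qed

section \<open>Theta series and their double series\<close>

text \<open>
  Jacobi's theta constant \<open>\<theta>\<^sub>3\<close>. Defining it by its product makes holomorphy and the absence of zeros
  immediate; the series is recovered below and is needed only for pointwise algebraic identities. The theta
  constant \<open>\<theta>\<^sub>4\<close> is \<open>theta3 (-q)\<close>.
\<close>

definition theta3 :: "complex \<Rightarrow> complex" where
  "theta3 q = euler_prod (-q) ^ 2 / euler_prod (q\<^sup>2)"

text \<open>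
  Jacobi's \<open>\<theta>\<^sub>2\<close> is \<open>2 q^(1/4) psi q\<close>; splitting off the fractional power keeps the function holomorphic.
\<close>

definition psi :: "complex \<Rightarrow> complex" where
  "psi q = euler_prod (q ^ 4) ^ 2 / euler_prod (q\<^sup>2)"

lemma theta3_has_sum:
  assumes q: "norm q < 1" "q \<noteq> 0"
  shows "((\<lambda>j::int. q powi (j\<^sup>2)) has_sum theta3 q) UNIV"
proof -
  have q2: "norm (q\<^sup>2) < 1" by (rule norm_power2_less_1[OF q(1)])
  have o: "(\<Prod>n. 1 + q ^ (2 * n + 1)) = odd_prod (-q)"
    unfolding odd_prod_def by simp
  have "euler_prod (-q) = odd_prod (-q) * euler_prod (q\<^sup>2)"
    using euler_prod_split[of "-q"] q by simp
  then have "euler_prod (q\<^sup>2) * odd_prod (-q) * odd_prod (-q) = theta3 q"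
    using euler_prod_nonzero[OF q2] by (simp add: theta3_def power2_eq_square field_simps)
  then show ?thesis
    using jacobi_triple_product[OF q, of 1] o by simp
qed

text \<open>
  The triple product at \<open>z = q\<close>. There the first factor of the product over \<open>1 + q^(2 n + 1) / z\<close> equals \<open>2\<close>,
  and the others repeat the product over \<open>1 + q^(2 n + 1) z\<close>.
\<close>

lemma psi_has_sum:
  assumes q: "norm q < 1" "q \<noteq> 0"
  shows "((\<lambda>j::int. q powi (j\<^sup>2 + j)) has_sum (2 * psi q)) UNIV"
proof -
  let ?Q = "q\<^sup>2"
  let ?p = "\<Prod>n. 1 + ?Q ^ Suc n"
  have q2: "norm ?Q < 1" by (rule norm_power2_less_1[OF q(1)])
  have q4: "norm (?Q\<^sup>2) < 1" by (rule norm_power2_less_1[OF q2])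
  have p: "(\<Prod>n. 1 + q ^ (2 * n + 1) * q) = ?p"
  proof (intro prodinf_cong)
    fix n
    have "q ^ (2 * n + 1) * q = q ^ (2 * Suc n)" by simp
    also have "\<dots> = ?Q ^ Suc n" by (rule power_mult)
    finally show "1 + q ^ (2 * n + 1) * q = 1 + ?Q ^ Suc n" by (rule arg_cong)
  qed
  have conv: "convergent_prod (\<lambda>n. 1 + ?Q ^ n)"
    using convergent_prod_one_plus_geometric[OF q2, of 1] by simp
  have nz: "1 + ?Q ^ n \<noteq> 0" for n
  proof (cases "n = 0")
    case False
    have "norm (?Q ^ n) < 1" by (rule norm_power_less_1[OF q2]) (use False in simp)
    then have "?Q ^ n \<noteq> -1" by (metis less_irrefl norm_minus_cancel norm_one)
    then show ?thesis by (metis add_eq_0_iff)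
  qed simp
  have "(\<Prod>n. 1 + q ^ (2 * n + 1) / q) = (\<Prod>n. 1 + ?Q ^ n)"
    using q(2) by (intro prodinf_cong) (simp add: power_mult)
  also have "\<dots> = 2 * ?p"
    using prodinf_split_head[OF conv nz] by (simp del: power_Suc add: mult.commute)
  finally have p': "(\<Prod>n. 1 + q ^ (2 * n + 1) / q) = 2 * ?p" .
  have pE: "?p * euler_prod ?Q = euler_prod (q ^ 4)"
  proof (rule LIMSEQ_unique)
    have "(\<lambda>N. \<Prod>n<N. 1 + ?Q ^ Suc n) \<longlonglongrightarrow> ?p"
      using prod_one_plus_geometric_LIMSEQ[OF q2, of ?Q] by simp
    from tendsto_mult[OF this euler_prod_LIMSEQ[OF q2]]
    show "(\<lambda>N. (\<Prod>n<N. 1 + ?Q ^ Suc n) * (\<Prod>n<N. 1 - ?Q ^ Suc n)) \<longlonglongrightarrow> ?p * euler_prod ?Q" .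
    have "(1 + ?Q ^ Suc n) * (1 - ?Q ^ Suc n) = 1 - (q ^ 4) ^ Suc n" for n
    proof -
      have "(q ^ 4) ^ Suc n = (?Q ^ Suc n)\<^sup>2" unfolding power_mult[symmetric] by (rule arg_cong[where f = "power q"]) simp
      then show ?thesis by (simp only: power2_eq_square) (simp only: algebra_simps, simp)
    qed
    then show "(\<lambda>N. (\<Prod>n<N. 1 + ?Q ^ Suc n) * (\<Prod>n<N. 1 - ?Q ^ Suc n)) \<longlonglongrightarrow> euler_prod (q ^ 4)"
      unfolding prod.distrib[symmetric] using euler_prod_LIMSEQ[of "q ^ 4"] q4 
      by (simp del: power_Suc flip: power_mult)
  qed
  have e: "euler_prod ?Q * ?p * (2 * ?p) = 2 * psi q"
    unfolding psi_def pE[symmetric] using euler_prod_nonzero[OF q2]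
    by (simp add: power2_eq_square)
  have pw: "q powi (j\<^sup>2) * q powi j = q powi (j\<^sup>2 + j)" for j
    using q(2) by (simp add: power_int_add)
  show ?thesis
    using jacobi_triple_product[OF q q(2)] unfolding p p' e pw .
qed

lemma has_sum_product:
  fixes f :: "'a \<Rightarrow> complex" and g :: "'b \<Rightarrow> complex"
  assumes f: "(f has_sum a) UNIV" and g: "(g has_sum b) UNIV"
  shows "((\<lambda>(i, j). f i * g j) has_sum (a * b)) UNIV"
proof -
  have fn: "(\<lambda>i. norm (f i)) summable_on UNIV" and gn: "(\<lambda>j. norm (g j)) summable_on UNIV"
    using f g summable_on_iff_abs_summable_on_complex has_sum_imp_summable by blast+
  have "(\<lambda>x. norm (case x of (i, j) \<Rightarrow> f i * g j)) summable_on (UNIV \<times> UNIV)"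
    unfolding Infinite_Sum.abs_summable_on_Sigma_iff
    using fn gn by (auto simp: norm_mult abs_mult infsum_cmult_right' infsum_nonneg
        intro!: summable_on_cmult_right summable_on_cmult_left)
  then have "(\<lambda>(i, j). f i * g j) summable_on (UNIV \<times> UNIV)"
    by (rule abs_summable_summable)
  moreover have "((\<lambda>j. (case (i, j) of (i, j) \<Rightarrow> f i * g j)) has_sum f i * b) UNIV" for i
    using has_sum_cmult_right[OF g] by simp
  ultimately show ?thesis
    using has_sum_SigmaI[where A = UNIV and B = "\<lambda>_. UNIV" and f = "\<lambda>(i, j). f i * g j"
        and g = "\<lambda>i. f i * b" and S = "a * b"] has_sum_cmult_left[OF f, of b] by (simp add: UNIV_Times_UNIV)
qed

lemma has_sum_parity_split:
  fixes f :: "int \<times> int \<Rightarrow> complex"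
  assumes "(f has_sum a) {(m, n). even (m + n)}" "(f has_sum b) {(m, n). odd (m + n)}"
  shows "(f has_sum (a + b)) UNIV"
proof -
  have "{(m, n). even (m + n)} \<union> {(m, n). odd (m + n)} = (UNIV :: (int \<times> int) set)" by auto
  moreover have "{(m, n). even (m + n)} \<inter> {(m, n). odd (m + n)} = ({} :: (int \<times> int) set)" by auto
  ultimately show ?thesis
    using has_sum_Un_disjoint[OF assms] by metis
qed

text \<open>
  In \<open>\<Sum> q^(m\<^sup>2 + n\<^sup>2)\<close> the pairs with even sum are \<open>(u + v, u - v)\<close> and contribute \<open>\<theta>\<^sub>3(q\<^sup>2)\<^sup>2\<close>; those with
  odd sum are \<open>(u + v + 1, u - v)\<close> and contribute \<open>\<theta>\<^sub>2(q\<^sup>2)\<^sup>2\<close>.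
\<close>

lemma theta3_squared_punctured:
  assumes q: "norm q < 1" "q \<noteq> 0"
  shows "theta3 q ^ 2 = theta3 (q\<^sup>2) ^ 2 + 4 * q * psi (q\<^sup>2) ^ 2"
proof -
  let ?Q = "q\<^sup>2"
  have Q: "norm ?Q < 1" "?Q \<noteq> 0" using norm_power2_less_1[OF q(1)] q(2) by auto
  have Qp: "?Q powi m = q powi (2 * m)" for m
    by (simp add: power_int_mult)
  let ?f = "\<lambda>(m::int, n::int). q powi (m\<^sup>2) * q powi (n\<^sup>2)"
  have all: "(?f has_sum (theta3 q * theta3 q)) UNIV"
    by (intro has_sum_product theta3_has_sum q)
  have "((\<lambda>(u, v). ?Q powi (u\<^sup>2) * ?Q powi (v\<^sup>2)) has_sum (theta3 ?Q * theta3 ?Q)) UNIV"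
    by (intro has_sum_product theta3_has_sum Q)
  also have "?this \<longleftrightarrow> (?f has_sum (theta3 ?Q * theta3 ?Q)) {(m, n). even (m + n)}"
  proof (rule has_sum_reindex_bij_witness[of _ "\<lambda>(m, n). ((m + n) div 2, (m - n) div 2)"
          "\<lambda>(u, v). (u + v, u - v)"], goal_cases)
    case (3 b)
    have "(m + n) div 2 + (m - n) div 2 = m" "(m + n) div 2 - (m - n) div 2 = n"
      if "even (m + n)" for m n :: int using that by presburger+
    with 3 show ?case by (cases b) (simp del: even_add)
  next
    case (5 a)
    obtain u v where a: "a = (u, v)" by (cases a)
    have "q powi (2 * u\<^sup>2) * q powi (2 * v\<^sup>2) = q powi (2 * u\<^sup>2 + 2 * v\<^sup>2)"
      using q(2) by (simp only: power_int_add simp_thms)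
    also have "\<dots> = q powi ((u + v)\<^sup>2 + (u - v)\<^sup>2)"
      by (rule arg_cong[where f = "power_int q"]) (simp add: power2_eq_square algebra_simps)
    finally show ?case
      using q(2) by (simp add: a Qp power_int_add)
  qed auto
  finally have even: "(?f has_sum (theta3 ?Q * theta3 ?Q)) {(m, n). even (m + n)}" .
  have "((\<lambda>x. q * (case x of (u, v) \<Rightarrow> ?Q powi (u\<^sup>2 + u) * ?Q powi (v\<^sup>2 + v)))
      has_sum (q * (2 * psi ?Q * (2 * psi ?Q)))) UNIV"
    by (intro has_sum_cmult_right has_sum_product psi_has_sum Q)
  also have "?this \<longleftrightarrow> (?f has_sum (q * (2 * psi ?Q * (2 * psi ?Q)))) {(m, n). odd (m + n)}"
  proof (rule has_sum_reindex_bij_witness[of _ "\<lambda>(m, n). ((m + n - 1) div 2, (m - n - 1) div 2)"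
          "\<lambda>(u, v). (u + v + 1, u - v)"], goal_cases)
    case (5 a)
    obtain u v where a: "a = (u, v)" by (cases a)
    have "q * (q powi (2 * (u\<^sup>2 + u)) * q powi (2 * (v\<^sup>2 + v)))
        = q powi (1 + (2 * (u\<^sup>2 + u) + 2 * (v\<^sup>2 + v)))"
      using q(2) by (simp only: power_int_add power_int_1_right simp_thms)
    also have "\<dots> = q powi ((u + v + 1)\<^sup>2 + (u - v)\<^sup>2)"
      by (rule arg_cong[where f = "power_int q"]) (simp add: power2_eq_square algebra_simps)
    finally show ?case
      using q(2) by (simp add: a Qp power_int_add)
  qed (auto, presburger+)
  finally have "(?f has_sum (q * (2 * psi ?Q * (2 * psi ?Q)))) {(m, n). odd (m + n)}" .
  from has_sum_unique[OF all has_sum_parity_split[OF even this]]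
  show ?thesis by (simp add: power2_eq_square)
qed

text \<open>
  Legendre's cubic modular equation \<open>\<theta>\<^sub>3 \<theta>\<^sub>3(q\<^sup>3) - \<theta>\<^sub>4 \<theta>\<^sub>4(q\<^sup>3) = \<theta>\<^sub>2 \<theta>\<^sub>2(q\<^sup>3)\<close>. The left-hand side is twice the sum of
  \<open>q^(m\<^sup>2 + 3 n\<^sup>2)\<close> over pairs of opposite parity. The right-hand side is a sum over pairs \<open>(2 a + 1, 2 b + 1)\<close>
  of odd numbers. Multiplication by a unit of the Eisenstein integers, in coordinates
  \<open>2 a + 1 = m + 3 n\<close> and \<open>2 b + 1 = m - n\<close>, matches the pairs \<open>(m, n)\<close> with those \<open>(a, b)\<close> for which \<open>a + b\<close>
  is even; the reflection \<open>b \<mapsto> -1 - b\<close> shows that the pairs with \<open>a + b\<close> odd contribute the same amount.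
\<close>

lemma theta3_cubic_punctured:
  assumes q: "norm q < 1" "q \<noteq> 0"
  shows "theta3 q * theta3 (q ^ 3) - theta3 (-q) * theta3 (- (q ^ 3))
    = 4 * q * psi q * psi (q ^ 3)"
proof -
  have q3: "norm (q ^ 3) < 1" "q ^ 3 \<noteq> 0" using norm_power_less_1[OF q(1), of 3] q(2) by auto
  have q3p: "(q ^ 3) powi m = q powi (3 * m)" for m
    by (simp add: power_int_mult)
  have sign: "(-x) powi (m\<^sup>2) = (if even m then 1 else -1) * x powi (m\<^sup>2)"
    for x :: complex and m :: int
    by (simp add: power_int_minus_left)
  have parity: "q powi (m\<^sup>2) * (q ^ 3) powi (n\<^sup>2) + (-1) * ((-q) powi (m\<^sup>2) * (- (q ^ 3)) powi (n\<^sup>2))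
      = (if even (m + n) then 0 else 2 * q powi (m\<^sup>2 + 3 * n\<^sup>2))" for m n
    unfolding sign using q(2) by (cases "even m"; cases "even n") (simp_all add: q3p power_int_add)
  define D where "D = theta3 q * theta3 (q ^ 3) - theta3 (-q) * theta3 (- (q ^ 3))"
  have "((\<lambda>(m, n). q powi (m\<^sup>2) * (q ^ 3) powi (n\<^sup>2)) has_sum (theta3 q * theta3 (q ^ 3))) UNIV"
    by (intro has_sum_product theta3_has_sum q q3)
  moreover have "((\<lambda>(m, n). (-q) powi (m\<^sup>2) * (- (q ^ 3)) powi (n\<^sup>2))
      has_sum (theta3 (-q) * theta3 (- (q ^ 3)))) UNIV"
    by (intro has_sum_product theta3_has_sum) (use q q3 in auto)
  ultimately have "((\<lambda>x. (case x of (m, n) \<Rightarrow> q powi (m\<^sup>2) * (q ^ 3) powi (n\<^sup>2))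
        + (-1) * (case x of (m, n) \<Rightarrow> (-q) powi (m\<^sup>2) * (- (q ^ 3)) powi (n\<^sup>2))) has_sum
        (theta3 q * theta3 (q ^ 3) + (-1) * (theta3 (-q) * theta3 (- (q ^ 3))))) UNIV"
    by (intro has_sum_add has_sum_cmult_right)
  then have "((\<lambda>x. (case x of (m, n) \<Rightarrow> q powi (m\<^sup>2) * (q ^ 3) powi (n\<^sup>2))
        + (-1) * (case x of (m, n) \<Rightarrow> (-q) powi (m\<^sup>2) * (- (q ^ 3)) powi (n\<^sup>2))) has_sum D) UNIV"
    by (simp add: D_def)
  also have "?this \<longleftrightarrow> ((\<lambda>(m, n). 2 * q powi (m\<^sup>2 + 3 * n\<^sup>2)) has_sum D) {(m, n). odd (m + n)}"
  proof (rule has_sum_cong_neutral, goal_cases)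
    case (2 x)
    then show ?case using parity[of "fst x" "snd x"] by (simp add: case_prod_unfold)
  next
    case (3 x)
    then show ?case using parity[of "fst x" "snd x"] by (simp add: case_prod_unfold)
  qed simp
  finally have "((\<lambda>x. (1 / 2) * (case x of (m, n) \<Rightarrow> 2 * q powi (m\<^sup>2 + 3 * n\<^sup>2))) has_sum (1 / 2 * D))
      {(m, n). odd (m + n)}"
    by (rule has_sum_cmult_right)
  then have odd: "((\<lambda>(m, n). q powi (m\<^sup>2 + 3 * n\<^sup>2)) has_sum (D / 2)) {(m, n). odd (m + n)}"
    by (simp add: case_prod_unfold)
  let ?h = "\<lambda>(a::int, b::int). q * (q powi (a\<^sup>2 + a) * (q ^ 3) powi (b\<^sup>2 + b))"
  \<comment> \<open>Both index sets are parametrized by the pairs \<open>(b, n)\<close>, via \<open>m = 2 b + n + 1\<close> and \<open>a = b + 2 n\<close>.\<close>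
  have "((\<lambda>(b, n). q powi ((2 * b + n + 1)\<^sup>2 + 3 * n\<^sup>2)) has_sum (D / 2)) UNIV
      \<longleftrightarrow> ((\<lambda>(m, n). q powi (m\<^sup>2 + 3 * n\<^sup>2)) has_sum (D / 2)) {(m, n). odd (m + n)}"
    by (rule has_sum_reindex_bij_witness[of _ "\<lambda>(m, n). ((m - n - 1) div 2, n)"
          "\<lambda>(b, n). (2 * b + n + 1, n)"]) (auto elim!: oddE)
  with odd have "((\<lambda>(b, n). q powi ((2 * b + n + 1)\<^sup>2 + 3 * n\<^sup>2)) has_sum (D / 2)) UNIV"
    by simp
  also have "?this \<longleftrightarrow> (?h has_sum (D / 2)) {(m, n). even (m + n)}"
  proof (rule has_sum_reindex_bij_witness[of _ "\<lambda>(a, b). (b, (a - b) div 2)"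
          "\<lambda>(b, n). (b + 2 * n, b)"], goal_cases)
    case (5 x)
    obtain b n where x: "x = (b, n)" by (cases x)
    have "q * (q powi ((b + 2 * n)\<^sup>2 + (b + 2 * n)) * q powi (3 * (b\<^sup>2 + b)))
        = q powi (1 + ((b + 2 * n)\<^sup>2 + (b + 2 * n) + 3 * (b\<^sup>2 + b)))"
      using q(2) by (simp only: power_int_add power_int_1_right simp_thms)
    also have "\<dots> = q powi ((2 * b + n + 1)\<^sup>2 + 3 * n\<^sup>2)"
      by (rule arg_cong[where f = "power_int q"]) (simp add: power2_eq_square algebra_simps)
    finally show ?case
      by (simp add: x q3p)
  qed auto
  finally have even: "(?h has_sum (D / 2)) {(m, n). even (m + n)}" .
  also have "?this \<longleftrightarrow> (?h has_sum (D / 2)) {(m, n). odd (m + n)}"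
    by (rule has_sum_reindex_bij_witness[of _ "\<lambda>(a, b). (a, - 1 - b)" "\<lambda>(a, b). (a, - 1 - b)"])
       (auto simp: power2_eq_square algebra_simps)
  finally have hD: "(?h has_sum D) UNIV"
    using has_sum_parity_split[OF even, of "D / 2"] by simp
  have "((\<lambda>x. q * (case x of (a, b) \<Rightarrow> q powi (a\<^sup>2 + a) * (q ^ 3) powi (b\<^sup>2 + b)))
      has_sum (q * (2 * psi q * (2 * psi (q ^ 3))))) UNIV"
    by (intro has_sum_cmult_right has_sum_product psi_has_sum q q3)
  then have "(?h has_sum (q * (2 * psi q * (2 * psi (q ^ 3))))) UNIV"
    by (simp only: case_prod_unfold)
  from has_sum_unique[OF hD this] show ?thesis by (simp add: D_def)
qed

lemma theta3_0 [simp]: "theta3 0 = 1" and psi_0 [simp]: "psi 0 = 1"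
  by (simp_all add: theta3_def psi_def)

lemma theta3_nonzero: "norm q < 1 \<Longrightarrow> theta3 q \<noteq> 0"
  and psi_nonzero: "norm q < 1 \<Longrightarrow> psi q \<noteq> 0"
  using euler_prod_nonzero norm_power_less_1[of q 2] norm_power_less_1[of q 4]
  by (auto simp: theta3_def psi_def)

lemma holomorphic_comp_power:
  assumes "f holomorphic_on ball 0 (1 :: real)" "k > 0"
  shows "(\<lambda>q :: complex. f (q ^ k)) holomorphic_on ball 0 1"
  using assms norm_power_less_1[of _ k]
  by (intro holomorphic_on_compose_gen[OF _ assms(1), unfolded o_def] holomorphic_intros) auto

lemma holomorphic_comp_uminus:
  assumes "f holomorphic_on ball 0 (1 :: real)"
  shows "(\<lambda>q :: complex. f (- q)) holomorphic_on ball 0 1"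
  by (intro holomorphic_on_compose_gen[OF _ assms(1), unfolded o_def] holomorphic_intros) auto

lemma holomorphic_theta3: "theta3 holomorphic_on ball 0 1"
  unfolding theta3_def[abs_def]
  by (intro holomorphic_intros holomorphic_comp_power holomorphic_comp_uminus holomorphic_euler_prod)
     (use euler_prod_nonzero norm_power2_less_1 in auto)

lemma holomorphic_psi: "psi holomorphic_on ball 0 1"
  unfolding psi_def[abs_def]
  by (intro holomorphic_intros holomorphic_comp_power holomorphic_comp_uminus holomorphic_euler_prod)
     (use euler_prod_nonzero norm_power2_less_1 in auto)

text \<open>
  The multiplicative half of the duplication formulas, the arithmetic-geometric mean step
  \<open>\<theta>\<^sub>4(q\<^sup>2)\<^sup>2 = \<theta>\<^sub>3 \<theta>\<^sub>4\<close>.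
\<close>

lemma theta3_times_theta3_uminus:
  assumes q: "norm q < 1"
  shows "theta3 q * theta3 (-q) = theta3 (- (q\<^sup>2)) ^ 2"
proof -
  have n: "norm (q\<^sup>2) < 1" "norm (q ^ 4) < 1"
    using q by (simp_all add: norm_power_less_1)
  have qq: "(q\<^sup>2)\<^sup>2 = q ^ 4" by (simp flip: power_mult)
  have nz: "euler_prod (q\<^sup>2) \<noteq> 0" "euler_prod (q ^ 4) \<noteq> 0"
    using n by (simp_all add: euler_prod_nonzero)
  have "theta3 q * euler_prod (q\<^sup>2) = euler_prod (-q) ^ 2"
    "theta3 (-q) * euler_prod (q\<^sup>2) = euler_prod q ^ 2"
    "theta3 (- (q\<^sup>2)) * euler_prod (q ^ 4) = euler_prod (q\<^sup>2) ^ 2"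
    using nz by (simp_all add: theta3_def qq)
  then have "theta3 q * theta3 (-q) * ((euler_prod (q\<^sup>2))\<^sup>2 * euler_prod (q ^ 4) ^ 2)
      = theta3 (- (q\<^sup>2)) ^ 2 * ((euler_prod (q\<^sup>2))\<^sup>2 * euler_prod (q ^ 4) ^ 2)"
    using euler_prod_uminus[OF q] by algebra
  then show ?thesis using nz by simp
qed

lemma psi_squared:
  assumes q: "norm q < 1"
  shows "psi q ^ 2 = theta3 (q\<^sup>2) * psi (q\<^sup>2)"
proof -
  have n: "norm (q\<^sup>2) < 1" "norm (q ^ 4) < 1" "norm (q ^ 8) < 1"
    using q by (simp_all add: norm_power_less_1)
  have qq: "(q\<^sup>2)\<^sup>2 = q ^ 4" "(q\<^sup>2) ^ 4 = q ^ 8" by (simp_all flip: power_mult)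
  have nz: "euler_prod (q\<^sup>2) \<noteq> 0" "euler_prod (q ^ 4) \<noteq> 0"
    using n by (simp_all add: euler_prod_nonzero)
  have "theta3 (q\<^sup>2) * euler_prod (q ^ 4) = euler_prod (- (q\<^sup>2)) ^ 2"
    "psi (q\<^sup>2) * euler_prod (q ^ 4) = euler_prod (q ^ 8) ^ 2"
    "psi q * euler_prod (q\<^sup>2) = euler_prod (q ^ 4) ^ 2"
    using nz by (simp_all add: theta3_def psi_def qq)
  moreover have "euler_prod (q\<^sup>2) * euler_prod (- (q\<^sup>2)) * euler_prod (q ^ 8) = euler_prod (q ^ 4) ^ 3"
    using euler_prod_uminus[OF n(1)] by (simp add: qq)
  ultimately have "psi q ^ 2 * ((euler_prod (q\<^sup>2))\<^sup>2 * euler_prod (q ^ 4) ^ 2)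
      = theta3 (q\<^sup>2) * psi (q\<^sup>2) * ((euler_prod (q\<^sup>2))\<^sup>2 * euler_prod (q ^ 4) ^ 2)"
    by algebra
  then show ?thesis using nz by simp
qed

lemma theta3_sq_add:
  assumes "norm q < 1"
  shows "theta3 q ^ 2 + theta3 (-q) ^ 2 = 2 * theta3 (q\<^sup>2) ^ 2"
proof (cases "q = 0")
  case False
  then show ?thesis using theta3_squared_punctured[of q] theta3_squared_punctured[of "-q"] assms by simp
qed simp

lemma theta3_sq_diff:
  assumes "norm q < 1"
  shows "theta3 q ^ 2 - theta3 (-q) ^ 2 = 8 * q * psi (q\<^sup>2) ^ 2"
proof (cases "q = 0")
  case False
  then show ?thesis using theta3_squared_punctured[of q] theta3_squared_punctured[of "-q"] assms by simp
qed simp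

text \<open>
  Jacobi's identity \<open>\<theta>\<^sub>3^4 = \<theta>\<^sub>4^4 + \<theta>\<^sub>2^4\<close>: the two preceding quadratic
  identities are multiplied, and \<open>psi_squared\<close> identifies the product.
\<close>

lemma jacobi_quartic:
  assumes "norm q < 1"
  shows "theta3 q ^ 4 - theta3 (-q) ^ 4 = 16 * q * psi q ^ 4"
proof -
  have "theta3 q ^ 4 - theta3 (-q) ^ 4
      = (theta3 q ^ 2 + theta3 (-q) ^ 2) * (theta3 q ^ 2 - theta3 (-q) ^ 2)" by algebra
  also have "\<dots> = 16 * q * (theta3 (q\<^sup>2) * psi (q\<^sup>2))\<^sup>2"
    unfolding theta3_sq_add[OF assms] theta3_sq_diff[OF assms] by algebra
  also have "\<dots> = 16 * q * psi q ^ 4"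
    unfolding psi_squared[OF assms, symmetric] by (simp flip: power_mult)
  finally show ?thesis .
qed

lemma theta3_cubic:
  assumes "norm q < 1"
  shows "theta3 q * theta3 (q ^ 3) - theta3 (-q) * theta3 (- (q ^ 3)) = 4 * q * psi q * psi (q ^ 3)"
proof (cases "q = 0")
  case False
  then show ?thesis by (rule theta3_cubic_punctured[OF assms])
qed simp

section \<open>Holomorphic functions on the disc and the map squaring the nome\<close>

lemma deriv_on_disc:
  assumes "f holomorphic_on ball 0 (1::real)" "norm (q :: complex) < 1"
  shows "(f has_field_derivative deriv f q) (at q)"
  using holomorphic_derivI[OF assms(1) open_ball, of q] assms(2) by simp

lemmas theta3_deriv = deriv_on_disc[OF holomorphic_theta3]

lemma holomorphic_deriv_theta3: "deriv theta3 holomorphic_on ball 0 1"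
  by (rule holomorphic_deriv[OF holomorphic_theta3 open_ball])

lemma deriv_eq_on_disc:
  fixes f g :: "complex \<Rightarrow> complex"
  assumes "\<And>q. norm q < 1 \<Longrightarrow> f q = g q" "norm q < 1"
    and "(f has_field_derivative f') (at q)" "(g has_field_derivative g') (at q)"
  shows "f' = g'"
proof -
  have "(g has_field_derivative f') (at q)"
    by (rule has_field_derivative_transform_within_open[OF assms(3), of "ball 0 1"]) (use assms in auto)
  then show ?thesis using assms(4) DERIV_unique by blast
qed

lemma tendsto_zero_iterated_square:
  fixes q :: complex
  assumes "norm q < 1"
  shows "(\<lambda>n. q ^ (2 ^ n)) \<longlonglongrightarrow> 0"
proof -
  have "strict_mono (\<lambda>n. 2 ^ n :: nat)" by (auto simp: strict_mono_def)
  from LIMSEQ_subseq_LIMSEQ[OF LIMSEQ_power_zero[OF assms] this] show ?thesis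
    by (simp add: o_def)
qed

text \<open>
  The orbit of \<open>q\<close> under squaring tends to \<open>0\<close>, so continuity at this one point suffices.
\<close>

lemma squaring_invariant_constant:
  fixes f :: "complex \<Rightarrow> complex"
  assumes cont: "isCont f 0" and inv: "\<And>q. norm q < 1 \<Longrightarrow> f (q\<^sup>2) = f q" and q: "norm q < 1"
  shows "f q = f 0"
proof -
  have "f (q ^ (2 ^ n)) = f q" for n
  proof (induction n)
    case (Suc n)
    have "norm (q ^ (2 ^ n)) < 1" using q by (intro norm_power_less_1) auto
    from inv[OF this] show ?case using Suc by (simp flip: power_mult add: mult.commute)
  qed simp
  moreover have "(\<lambda>n. f (q ^ (2 ^ n))) \<longlonglongrightarrow> f 0"
    by (rule isCont_tendsto_compose[OF cont tendsto_zero_iterated_square[OF q]])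
  ultimately show ?thesis
    by (simp add: LIMSEQ_const_iff)
qed

text \<open>
  Iteration gives \<open>f q = 4^n f(w)\<close> with \<open>w = q^(2^n)\<close>. Since \<open>f\<close> vanishes at \<open>0\<close>, \<open>f(w)\<close> is of order \<open>w\<close>, and
  \<open>4^n q^(2^n)\<close> tends to zero.
\<close>

lemma squaring_quarter_imp_zero:
  fixes f :: "complex \<Rightarrow> complex"
  assumes der: "(f has_field_derivative d) (at 0)" and f0: "f 0 = 0"
    and inv: "\<And>q. norm q < 1 \<Longrightarrow> 4 * f (q\<^sup>2) = f q" and q: "norm q < 1"
  shows "f q = 0"
proof (cases "q = 0")
  case False
  have it: "f q = 4 ^ n * f (q ^ (2 ^ n))" for n
  proof (induction n)
    case (Suc n)
    have "norm (q ^ (2 ^ n)) < 1" using q by (intro norm_power_less_1) auto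
    from inv[OF this] Suc show ?case by (simp flip: power_mult add: mult.commute)
  qed simp
  let ?w = "\<lambda>n. q ^ (2 ^ n)"
  have nz: "?w n \<noteq> 0" for n using False by simp
  have "((\<lambda>h. f h / h) \<longlongrightarrow> d) (at 0)"
    using der f0 by (simp add: DERIV_def)
  moreover have "filterlim ?w (at 0) sequentially"
    using tendsto_zero_iterated_square[OF q] nz by (simp add: filterlim_at)
  ultimately have 1: "(\<lambda>n. f (?w n) / ?w n) \<longlonglongrightarrow> d"
    by (rule filterlim_compose)
  \<comment> \<open>With \<open>m = 2^n\<close>, \<open>4^n q^(2^n)\<close> is the square of \<open>m x^m\<close>, where \<open>x\<close> is a square root of \<open>q\<close>.\<close>
  define x where "x = csqrt q"
  have x2: "x\<^sup>2 = q" by (simp add: x_def)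
  have "norm x ^ 2 < 1" using q x2 by (metis norm_power)
  then have "norm x < 1" by (simp add: power_less_one_iff)
  then have "(\<lambda>m. of_nat m * x ^ m) \<longlonglongrightarrow> 0" by (rule powser_times_n_limit_0)
  from LIMSEQ_subseq_LIMSEQ[OF this, of "\<lambda>n. 2 ^ n"]
  have "(\<lambda>n. of_nat (2 ^ n) * x ^ (2 ^ n)) \<longlonglongrightarrow> 0"
    by (simp add: o_def strict_mono_def)
  then have "(\<lambda>n. (of_nat (2 ^ n) * x ^ (2 ^ n))\<^sup>2) \<longlonglongrightarrow> 0\<^sup>2"
    by (rule tendsto_power)
  moreover have "(of_nat (2 ^ n) * x ^ (2 ^ n))\<^sup>2 = 4 ^ n * ?w n" for n
  proof -
    have "(x ^ (2 ^ n))\<^sup>2 = ?w n"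
      unfolding x2[symmetric] by (simp flip: power_mult add: mult.commute)
    moreover have "(of_nat (2 ^ n))\<^sup>2 = (4 ^ n :: complex)"
      by (simp add: power2_eq_square flip: power_mult_distrib)
    ultimately show ?thesis by (simp add: power_mult_distrib)
  qed
  ultimately have 2: "(\<lambda>n. 4 ^ n * ?w n) \<longlonglongrightarrow> 0" by simp
  have "(\<lambda>n. (4 ^ n * ?w n) * (f (?w n) / ?w n)) \<longlonglongrightarrow> 0 * d"
    by (rule tendsto_mult[OF 2 1])
  moreover have "(4 ^ n * ?w n) * (f (?w n) / ?w n) = f q" for n
    using it[of n] nz[of n] by simp
  ultimately show ?thesis by (simp add: LIMSEQ_const_iff)
qed (simp add: f0)

section \<open>Differential equations of the theta functions in level two\<close>

lemma holomorphic_chain_on_disc: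
  fixes f :: "complex \<Rightarrow> complex"
  assumes "f holomorphic_on ball 0 1" "norm (g q) < 1" "(g has_field_derivative g') (at q)"
  shows "((\<lambda>x. f (g x)) has_field_derivative deriv f (g q) * g') (at q)"
  by (rule DERIV_chain2[where f = f and g = g, OF deriv_on_disc[OF assms(1,2)] assms(3)])

lemma theta3_minus_deriv:
  assumes "norm q < 1"
  shows "((\<lambda>q. theta3 (-q)) has_field_derivative - deriv theta3 (-q)) (at q)"
  using holomorphic_chain_on_disc[OF holomorphic_theta3 _ DERIV_minus[OF DERIV_ident, of q UNIV]] assms
  by simp

lemma theta3_power_deriv:
  assumes "norm q < 1" "k > 0"
  shows "((\<lambda>q. theta3 (q ^ k)) has_field_derivative deriv theta3 (q ^ k) * (of_nat k * q ^ (k - 1))) (at q)"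
  using norm_power_less_1[OF assms]
  by (intro holomorphic_chain_on_disc holomorphic_theta3) (auto intro!: derivative_eq_intros)

lemma psi_power_deriv:
  assumes "norm q < 1" "k > 0"
  shows "((\<lambda>q. psi (q ^ k)) has_field_derivative deriv psi (q ^ k) * (of_nat k * q ^ (k - 1))) (at q)"
  using norm_power_less_1[OF assms]
  by (intro holomorphic_chain_on_disc holomorphic_psi) (auto intro!: derivative_eq_intros)

lemma deriv_theta3_0: "deriv theta3 0 = 2"
proof -
  have "2 * deriv theta3 0 + 2 * deriv theta3 0 = 8"
  proof (rule deriv_eq_on_disc[of "\<lambda>q. theta3 q ^ 2 - theta3 (-q) ^ 2" "\<lambda>q. 8 * q * psi (q\<^sup>2) ^ 2" 0])
    show "((\<lambda>q. theta3 q ^ 2 - theta3 (-q) ^ 2) has_field_derivative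
        2 * deriv theta3 0 + 2 * deriv theta3 0) (at 0)"
      by (rule derivative_eq_intros theta3_deriv theta3_minus_deriv refl | simp)+
    show "((\<lambda>q. 8 * q * psi (q\<^sup>2) ^ 2) has_field_derivative 8) (at 0)"
      by (rule derivative_eq_intros psi_power_deriv refl | simp)+
  qed (use theta3_sq_diff in auto)
  then show ?thesis by simp
qed

text \<open>
  The function \<open>M = D(\<theta>\<^sub>3\<^sup>2) / \<theta>\<^sub>3\<^sup>2\<close> with \<open>D = q d/dq\<close>; the corresponding function for \<open>\<theta>\<^sub>4\<close> is \<open>M(-q)\<close>.
\<close>

definition ld_theta :: "complex \<Rightarrow> complex" where
  "ld_theta q = 2 * (q * deriv theta3 q) / theta3 q"

lemma ld_theta_eq: "norm q < 1 \<Longrightarrow> 2 * (q * deriv theta3 q) = ld_theta q * theta3 q"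
  using theta3_nonzero by (simp add: ld_theta_def)

lemma ld_theta_0 [simp]: "ld_theta 0 = 0"
  by (simp add: ld_theta_def)

lemma holomorphic_ld_theta: "ld_theta holomorphic_on ball 0 1"
  unfolding ld_theta_def[abs_def]
  by (intro holomorphic_intros holomorphic_theta3 holomorphic_deriv_theta3)
     (use theta3_nonzero in auto)

text \<open>
  The logarithmic derivative of \<open>\<theta>\<^sub>3\<^sup>2 + \<theta>\<^sub>4\<^sup>2 = 2 \<theta>\<^sub>3(q\<^sup>2)\<^sup>2\<close>, cleared of denominators.
\<close>

lemma ld_theta_doubling:
  assumes q: "norm q < 1"
  shows "2 * ld_theta (q\<^sup>2) * (theta3 q ^ 2 + theta3 (-q) ^ 2)
    = ld_theta q * theta3 q ^ 2 + ld_theta (-q) * theta3 (-q) ^ 2"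
proof -
  have q2: "norm (q\<^sup>2) < 1" by (rule norm_power2_less_1[OF q])
  have "2 * theta3 q * deriv theta3 q - 2 * theta3 (-q) * deriv theta3 (-q)
      = 2 * (2 * theta3 (q\<^sup>2) * (deriv theta3 (q\<^sup>2) * (2 * q)))"
  proof (rule deriv_eq_on_disc[of "\<lambda>q. theta3 q ^ 2 + theta3 (-q) ^ 2" "\<lambda>q. 2 * theta3 (q\<^sup>2) ^ 2" q])
    show "((\<lambda>q. theta3 q ^ 2 + theta3 (-q) ^ 2) has_field_derivative
        2 * theta3 q * deriv theta3 q - 2 * theta3 (-q) * deriv theta3 (-q)) (at q)"
      by (rule derivative_eq_intros theta3_deriv theta3_minus_deriv refl q | simp)+
    show "((\<lambda>q. 2 * theta3 (q\<^sup>2) ^ 2) has_field_derivative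
        2 * (2 * theta3 (q\<^sup>2) * (deriv theta3 (q\<^sup>2) * (2 * q)))) (at q)"
      by (rule derivative_eq_intros theta3_power_deriv refl q | simp)+
  qed (use theta3_sq_add q in auto)
  then have "q * (2 * theta3 q * deriv theta3 q - 2 * theta3 (-q) * deriv theta3 (-q))
      = q * (2 * (2 * theta3 (q\<^sup>2) * (deriv theta3 (q\<^sup>2) * (2 * q))))"
    by simp
  then have "theta3 q * (2 * (q * deriv theta3 q)) + theta3 (-q) * (2 * (-q * deriv theta3 (-q)))
      = 4 * theta3 (q\<^sup>2) * (2 * (q\<^sup>2 * deriv theta3 (q\<^sup>2)))"
    by (simp add: power2_eq_square algebra_simps)
  then have "theta3 q * (ld_theta q * theta3 q) + theta3 (-q) * (ld_theta (-q) * theta3 (-q))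
      = 4 * theta3 (q\<^sup>2) * (ld_theta (q\<^sup>2) * theta3 (q\<^sup>2))"
    using ld_theta_eq[of "-q"] q by (simp only: ld_theta_eq[OF q] ld_theta_eq[OF q2] norm_minus_cancel)
  with theta3_sq_add[OF q] show ?thesis by algebra
qed

text \<open>
  The logarithmic derivative of \<open>\<theta>\<^sub>3 \<theta>\<^sub>4 = \<theta>\<^sub>4(q\<^sup>2)\<^sup>2\<close>.
\<close>

lemma ld_theta_doubling_minus:
  assumes q: "norm q < 1"
  shows "4 * ld_theta (- (q\<^sup>2)) = ld_theta q + ld_theta (-q)"
proof -
  have q2: "norm (q\<^sup>2) < 1" by (rule norm_power2_less_1[OF q])
  have "deriv theta3 q * theta3 (-q) - theta3 q * deriv theta3 (-q)
      = 2 * theta3 (- (q\<^sup>2)) * (- deriv theta3 (- (q\<^sup>2)) * (2 * q))"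
  proof (rule deriv_eq_on_disc[of "\<lambda>q. theta3 q * theta3 (-q)" "\<lambda>q. theta3 (- (q\<^sup>2)) ^ 2" q])
    show "((\<lambda>q. theta3 q * theta3 (-q)) has_field_derivative
        deriv theta3 q * theta3 (-q) - theta3 q * deriv theta3 (-q)) (at q)"
      by (rule derivative_eq_intros theta3_deriv theta3_minus_deriv refl q | simp)+
    have "((\<lambda>q. theta3 (- (q\<^sup>2))) has_field_derivative deriv theta3 (- (q\<^sup>2)) * - (2 * q)) (at q)"
      using q2 by (intro holomorphic_chain_on_disc holomorphic_theta3) (auto intro!: derivative_eq_intros)
    then show "((\<lambda>q. theta3 (- (q\<^sup>2)) ^ 2) has_field_derivative
        2 * theta3 (- (q\<^sup>2)) * (- deriv theta3 (- (q\<^sup>2)) * (2 * q))) (at q)"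
      by (rule derivative_eq_intros refl | simp)+
  qed (use theta3_times_theta3_uminus q in auto)
  then have "2 * q * (deriv theta3 q * theta3 (-q) - theta3 q * deriv theta3 (-q))
      = 2 * q * (2 * theta3 (- (q\<^sup>2)) * (- deriv theta3 (- (q\<^sup>2)) * (2 * q)))"
    by simp
  then have "theta3 (-q) * (2 * (q * deriv theta3 q)) + theta3 q * (2 * (-q * deriv theta3 (-q)))
      = 4 * theta3 (- (q\<^sup>2)) * (2 * (- (q\<^sup>2) * deriv theta3 (- (q\<^sup>2))))"
    by (simp add: power2_eq_square algebra_simps)
  then have "theta3 (-q) * (ld_theta q * theta3 q) + theta3 q * (ld_theta (-q) * theta3 (-q))
      = 4 * theta3 (- (q\<^sup>2)) * (ld_theta (- (q\<^sup>2)) * theta3 (- (q\<^sup>2)))"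
    using ld_theta_eq[of "-q"] ld_theta_eq[of "- (q\<^sup>2)"] q q2
    by (simp only: ld_theta_eq[OF q] norm_minus_cancel)
  then have "(ld_theta q + ld_theta (-q)) * (theta3 q * theta3 (-q))
      = 4 * ld_theta (- (q\<^sup>2)) * (theta3 q * theta3 (-q))"
    using theta3_times_theta3_uminus[OF q] by algebra
  then show ?thesis using theta3_nonzero[OF q] theta3_nonzero[of "-q"] q by simp
qed

text \<open>
  By the two duplication formulas, \<open>M(q) - M(-q)\<close> and \<open>\<theta>\<^sub>2^4\<close> are multiplied by the same factor when \<open>q\<close> is
  replaced by \<open>q\<^sup>2\<close>. Their quotient is therefore constant, and its value is found at \<open>q = 0\<close>.
\<close>

theorem ld_theta_diff:
  assumes q: "norm q < 1"
  shows "ld_theta q - ld_theta (-q) = (theta3 q ^ 4 - theta3 (-q) ^ 4) / 2"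
proof -
  \<comment> \<open>Dividing by \<open>q\<close> removes the common zero of both sides at the origin.\<close>
  define v where "v q = 2 * deriv theta3 q / theta3 q + 2 * deriv theta3 (-q) / theta3 (-q)" for q
  have ldv: "ld_theta q - ld_theta (-q) = q * v q" for q
    by (simp add: ld_theta_def v_def algebra_simps)
  have hv: "(\<lambda>q. v q / psi q ^ 4) holomorphic_on ball 0 1"
    unfolding v_def
    by (intro holomorphic_intros holomorphic_theta3 holomorphic_comp_uminus holomorphic_deriv_theta3
        holomorphic_psi) (use theta3_nonzero psi_nonzero in auto)
  have "v q / psi q ^ 4 = v 0 / psi 0 ^ 4"
  proof (rule squaring_invariant_constant[OF _ _ q])
    show "isCont (\<lambda>q. v q / psi q ^ 4) 0"
      using hv by (meson centre_in_ball continuous_on_eq_continuous_at holomorphic_on_imp_continuous_on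
          open_ball zero_less_one)
  next
    fix q :: complex assume q: "norm q < 1"
    have q2: "norm (q\<^sup>2) < 1" by (rule norm_power2_less_1[OF q])
    show "v (q\<^sup>2) / psi (q\<^sup>2) ^ 4 = v q / psi q ^ 4"
    proof (cases "q = 0")
      case False
      let ?f = "theta3 q ^ 2" and ?g = "theta3 (-q) ^ 2"
      have fg: "?f + ?g \<noteq> 0"
        using theta3_sq_add[OF q] theta3_nonzero[OF q2] by simp
      have c: "?f ^ 2 - ?g ^ 2 = 16 * q * psi q ^ 4"
        using jacobi_quartic[OF q] by (simp flip: power_mult)
      have c1: "(?f - ?g) ^ 2 = 4 * (16 * q\<^sup>2 * psi (q\<^sup>2) ^ 4)"
        unfolding theta3_sq_diff[OF q] by algebra
      have "(ld_theta (q\<^sup>2) - ld_theta (- (q\<^sup>2))) * (?f + ?g) * 4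
          = (ld_theta q - ld_theta (-q)) * (?f - ?g)"
        using ld_theta_doubling[OF q] ld_theta_doubling_minus[OF q] by algebra
      then have "(q\<^sup>2 * v (q\<^sup>2)) * (?f + ?g) * 4 = (q * v q) * (?f - ?g)"
        by (simp add: ldv)
      then have "(q\<^sup>2 * v (q\<^sup>2)) * (16 * q * psi q ^ 4) * 4 = (q * v q) * (4 * (16 * q\<^sup>2 * psi (q\<^sup>2) ^ 4))"
        unfolding c[symmetric] c1[symmetric] by algebra
      then have "v (q\<^sup>2) * psi q ^ 4 = v q * psi (q\<^sup>2) ^ 4"
        using False by (simp add: power2_eq_square)
      then show ?thesis
        using psi_nonzero[OF q] psi_nonzero[OF q2] by (simp add: frac_eq_eq)
    qed simp
  qed
  moreover have "v 0 = 8" by (simp add: v_def deriv_theta3_0)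
  ultimately have "v q = 8 * psi q ^ 4"
    using psi_nonzero[OF q] by (simp add: divide_eq_eq)
  then show ?thesis
    using ldv[of q] jacobi_quartic[OF q] by simp
qed

text \<open>
  Eliminating \<open>M(-q)\<close> from the duplication formula leaves a relation between \<open>M(q\<^sup>2)\<close> and \<open>M(q)\<close> that is
  polynomial in \<open>\<theta>\<^sub>3\<^sup>2\<close> and \<open>\<theta>\<^sub>4\<^sup>2\<close>, so it can be differentiated once more.
\<close>

lemma ld_theta_squared:
  assumes q: "norm q < 1"
  shows "2 * ld_theta (q\<^sup>2) = ld_theta q - theta3 (-q) ^ 2 * (theta3 q ^ 2 - theta3 (-q) ^ 2) / 2"
proof -
  let ?f = "theta3 q ^ 2" and ?g = "theta3 (-q) ^ 2"
  have "?f + ?g \<noteq> 0"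
    using theta3_sq_add[OF q] theta3_nonzero[OF norm_power2_less_1[OF q]] by simp
  moreover have "2 * ld_theta (-q) = 2 * ld_theta q - (?f ^ 2 - ?g ^ 2)"
    using ld_theta_diff[OF q] by (simp add: field_simps flip: power_mult)
  then have "4 * ld_theta (q\<^sup>2) * (?f + ?g) = (2 * ld_theta q - ?g * (?f - ?g)) * (?f + ?g)"
    using ld_theta_doubling[OF q] by algebra
  ultimately have "4 * ld_theta (q\<^sup>2) = 2 * ld_theta q - ?g * (?f - ?g)"
    by simp
  moreover have "2 * ld_theta (q\<^sup>2) = 4 * ld_theta (q\<^sup>2) / 2"
    by simp
  ultimately show ?thesis by (simp add: diff_divide_distrib)
qed

lemma theta3_sq_deriv:
  assumes q: "norm q < 1" "q \<noteq> 0"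
  shows "((\<lambda>q. theta3 q ^ 2) has_field_derivative ld_theta q * theta3 q ^ 2 / q) (at q)"
    "((\<lambda>q. theta3 (-q) ^ 2) has_field_derivative ld_theta (-q) * theta3 (-q) ^ 2 / q) (at q)"
proof -
  have "((\<lambda>q. theta3 q ^ 2) has_field_derivative 2 * theta3 q * deriv theta3 q) (at q)"
    by (rule derivative_eq_intros theta3_deriv refl q | simp)+
  moreover have "2 * theta3 q * deriv theta3 q = ld_theta q * theta3 q ^ 2 / q"
    using theta3_nonzero[OF q(1)] q(2) by (simp add: ld_theta_def field_simps power2_eq_square)
  ultimately show "((\<lambda>q. theta3 q ^ 2) has_field_derivative ld_theta q * theta3 q ^ 2 / q) (at q)"
    by simp
  have "((\<lambda>q. theta3 (-q) ^ 2) has_field_derivative 2 * theta3 (-q) * - deriv theta3 (-q)) (at q)"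
    by (rule derivative_eq_intros theta3_minus_deriv refl q | simp)+
  moreover have "2 * theta3 (-q) * - deriv theta3 (-q) = ld_theta (-q) * theta3 (-q) ^ 2 / q"
    using theta3_nonzero[of "-q"] q by (simp add: ld_theta_def field_simps power2_eq_square)
  ultimately show "((\<lambda>q. theta3 (-q) ^ 2) has_field_derivative ld_theta (-q) * theta3 (-q) ^ 2 / q) (at q)"
    by simp
qed

text \<open>
  Jacobi's second order differential equation for \<open>\<theta>\<^sub>3\<^sup>2\<close> as a Riccati equation for its logarithmic
  derivative. In the difference \<open>G\<close> of the two sides the terms containing \<open>M\<close> cancel under duplication, which
  leaves \<open>4 G(q\<^sup>2) = G(q)\<close>; and \<open>G\<close> vanishes at the origin.
\<close>

theorem ld_theta_riccati:
  assumes q: "norm q < 1"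
  shows "q * deriv ld_theta q
    = ld_theta q ^ 2 + theta3 (-q) ^ 4 * (theta3 q ^ 4 - theta3 (-q) ^ 4) / 4"
proof -
  define G where "G q = q * deriv ld_theta q - ld_theta q ^ 2
      - theta3 (-q) ^ 4 * (theta3 q ^ 4 - theta3 (-q) ^ 4) / 4" for q
  have "G holomorphic_on ball 0 1"
    unfolding G_def[abs_def]
    by (intro holomorphic_intros holomorphic_deriv holomorphic_ld_theta holomorphic_theta3
        holomorphic_comp_uminus) auto
  then have der: "(G has_field_derivative deriv G 0) (at 0)"
    by (rule deriv_on_disc) simp
  have "G q = 0"
  proof (rule squaring_quarter_imp_zero[OF der _ _ q])
    show "G 0 = 0" by (simp add: G_def)
    fix q :: complex assume q: "norm q < 1"
    have q2: "norm (q\<^sup>2) < 1" by (rule norm_power2_less_1[OF q])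
    show "4 * G (q\<^sup>2) = G q"
    proof (cases "q = 0")
      case False
      define f g m n m1 where "f = theta3 q ^ 2" and "g = theta3 (-q) ^ 2"
        and "m = ld_theta q" and "n = ld_theta (-q)" and "m1 = ld_theta (q\<^sup>2)"
      have mn: "2 * n = 2 * m - (f ^ 2 - g ^ 2)"
        using ld_theta_diff[OF q] by (simp add: f_def g_def m_def n_def field_simps flip: power_mult)
      have mm: "4 * m1 = 2 * m - g * (f - g)"
        using ld_theta_squared[OF q] by (simp add: f_def g_def m_def m1_def field_simps)
      have "2 * (deriv ld_theta (q\<^sup>2) * (2 * q))
          = deriv ld_theta q - (n * g / q * (f - g) + g * (m * f / q - n * g / q)) / 2"
      proof (rule deriv_eq_on_disc[of "\<lambda>q. 2 * ld_theta (q\<^sup>2)"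
            "\<lambda>q. ld_theta q - theta3 (-q) ^ 2 * (theta3 q ^ 2 - theta3 (-q) ^ 2) / 2" q])
        have "((\<lambda>q. ld_theta (q\<^sup>2)) has_field_derivative deriv ld_theta (q\<^sup>2) * (2 * q)) (at q)"
          using q2 by (intro holomorphic_chain_on_disc holomorphic_ld_theta) (auto intro!: derivative_eq_intros)
        then show "((\<lambda>q. 2 * ld_theta (q\<^sup>2)) has_field_derivative 2 * (deriv ld_theta (q\<^sup>2) * (2 * q))) (at q)"
          by (rule DERIV_cmult)
        show "((\<lambda>q. ld_theta q - theta3 (-q) ^ 2 * (theta3 q ^ 2 - theta3 (-q) ^ 2) / 2)
            has_field_derivative
            deriv ld_theta q - (n * g / q * (f - g) + g * (m * f / q - n * g / q)) / 2) (at q)"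
          unfolding f_def g_def m_def n_def
          by (rule derivative_eq_intros theta3_sq_deriv[OF q False]
              deriv_on_disc[OF holomorphic_ld_theta q] refl | simp)+
      qed (use ld_theta_squared q in auto)
      moreover have "4 * (q\<^sup>2 * deriv ld_theta (q\<^sup>2)) = q * (2 * (deriv ld_theta (q\<^sup>2) * (2 * q)))"
        by (simp add: power2_eq_square)
      ultimately have "4 * (q\<^sup>2 * deriv ld_theta (q\<^sup>2))
          = q * (deriv ld_theta q - (n * g / q * (f - g) + g * (m * f / q - n * g / q)) / 2)"
        by (simp only:)
      also have "\<dots> = q * deriv ld_theta q - (n * g * (f - g) + g * (m * f - n * g)) / 2"
        using False by (simp add: field_simps)
      finally have D: "8 * (q\<^sup>2 * deriv ld_theta (q\<^sup>2))
          = 2 * (q * deriv ld_theta q) - (n * g * (f - g) + g * (m * f - n * g))"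
        by (simp add: field_simps)
      have t1: "theta3 (- (q\<^sup>2)) ^ 4 = f * g"
        using theta3_times_theta3_uminus[OF q]
        by (simp add: f_def g_def power_mult_distrib[symmetric] flip: power_mult)
      have "4 * theta3 (q\<^sup>2) ^ 4 = (2 * theta3 (q\<^sup>2) ^ 2) ^ 2" by algebra
      then have t2: "4 * theta3 (q\<^sup>2) ^ 4 = (f + g) ^ 2"
        using theta3_sq_add[OF q] by (simp add: f_def g_def)
      have "16 * G (q\<^sup>2) = 2 * (8 * (q\<^sup>2 * deriv ld_theta (q\<^sup>2))) - (4 * m1) ^ 2
          - theta3 (- (q\<^sup>2)) ^ 4 * (4 * theta3 (q\<^sup>2) ^ 4 - 4 * theta3 (- (q\<^sup>2)) ^ 4)"
        by (simp add: G_def m1_def power_mult_distrib algebra_simps diff_divide_distrib)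
      also have "\<dots> = 2 * (2 * (q * deriv ld_theta q) - (n * g * (f - g) + g * (m * f - n * g)))
          - (2 * m - g * (f - g)) ^ 2 - f * g * ((f + g) ^ 2 - 4 * (f * g))"
        unfolding D mm t1 t2 ..
      also have "\<dots> = 4 * (q * deriv ld_theta q) - 4 * m ^ 2 - g ^ 2 * (f ^ 2 - g ^ 2)"
        using mn by algebra
      also have "\<dots> = 4 * G q"
        by (simp add: G_def f_def g_def m_def flip: power_mult)
      finally show ?thesis by simp
    qed (simp add: G_def)
  qed
  then show ?thesis by (simp add: G_def algebra_simps)
qed

section \<open>The parametrization of the cubic modular equation\<close>

text \<open>
  The eta quotient \<open>x\<close> in the nome; its fractional powers of \<open>q\<close> cancel completely.
\<close>

definition x_nome :: "complex \<Rightarrow> complex" where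
  "x_nome q = (euler_prod (q\<^sup>2) ^ 3 * euler_prod (q ^ 3) ^ 6 * euler_prod (q ^ 12) ^ 3) /
     (euler_prod q ^ 2 * euler_prod (q ^ 4) * euler_prod (q ^ 6) ^ 9)"

text \<open>
  The eta quotient \<open>Q\<close> in the nome; the fractional powers of \<open>q\<close> combine to the factor \<open>q\<close>.
\<close>

definition Q_nome :: "complex \<Rightarrow> complex" where
  "Q_nome q = q * (euler_prod q * euler_prod (q ^ 6) ^ 6) /
     (euler_prod (q\<^sup>2) ^ 2 * euler_prod (q ^ 3) ^ 3)"

lemma euler_prod_power_nonzero: "norm q < 1 \<Longrightarrow> k > 0 \<Longrightarrow> euler_prod (q ^ k) \<noteq> 0"
  by (intro euler_prod_nonzero norm_power_less_1)

lemma holomorphic_x_nome: "x_nome holomorphic_on ball 0 1"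
  unfolding x_nome_def[abs_def]
  by (intro holomorphic_intros holomorphic_comp_power holomorphic_euler_prod)
     (use euler_prod_nonzero euler_prod_power_nonzero in auto)

lemma holomorphic_Q_nome: "Q_nome holomorphic_on ball 0 1"
  unfolding Q_nome_def[abs_def]
  by (intro holomorphic_intros holomorphic_comp_power holomorphic_euler_prod)
     (use euler_prod_nonzero euler_prod_power_nonzero in auto)

lemma x_nome_0 [simp]: "x_nome 0 = 1"
  by (simp add: x_nome_def)

lemma x_nome_nonzero: "norm q < 1 \<Longrightarrow> x_nome q \<noteq> 0"
  using euler_prod_nonzero euler_prod_power_nonzero by (simp add: x_nome_def)

lemma Q_nome_nonzero: "norm q < 1 \<Longrightarrow> q \<noteq> 0 \<Longrightarrow> Q_nome q \<noteq> 0"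
  using euler_prod_nonzero euler_prod_power_nonzero by (simp add: Q_nome_def)

lemma theta3_eta_quotient:
  assumes q: "norm q < 1"
  shows "theta3 q = euler_prod (q\<^sup>2) ^ 5 / (euler_prod q ^ 2 * euler_prod (q ^ 4) ^ 2)"
    and "theta3 (-q) = euler_prod q ^ 2 / euler_prod (q\<^sup>2)"
proof -
  have nz: "euler_prod q \<noteq> 0" "euler_prod (q\<^sup>2) \<noteq> 0" "euler_prod (q ^ 4) \<noteq> 0"
    using q by (simp_all add: euler_prod_nonzero euler_prod_power_nonzero)
  have "theta3 q * euler_prod (q\<^sup>2) = euler_prod (-q) ^ 2"
    using nz by (simp add: theta3_def)
  then have "theta3 q * (euler_prod q ^ 2 * euler_prod (q ^ 4) ^ 2) * euler_prod (q\<^sup>2)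
      = euler_prod (q\<^sup>2) ^ 5 * euler_prod (q\<^sup>2)"
    using euler_prod_uminus[OF q] by algebra
  then show "theta3 q = euler_prod (q\<^sup>2) ^ 5 / (euler_prod q ^ 2 * euler_prod (q ^ 4) ^ 2)"
    using nz by (simp add: eq_divide_eq)
qed (simp add: theta3_def)

text \<open>
  Comparing exponents of the eta functions shows \<open>x\<^sup>2 = (\<theta>\<^sub>3 / \<theta>\<^sub>4) (\<theta>\<^sub>4(q\<^sup>3) / \<theta>\<^sub>3(q\<^sup>3))\<^sup>3\<close>.
\<close>

lemma x_nome_theta:
  assumes q: "norm q < 1"
  shows "x_nome q ^ 2 * theta3 (-q) * theta3 (q ^ 3) ^ 3 = theta3 q * theta3 (- (q ^ 3)) ^ 3"
proof -
  have q3: "norm (q ^ 3) < 1" using q by (simp add: norm_power_less_1)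
  have pw: "(q ^ 3)\<^sup>2 = q ^ 6" "(q ^ 3) ^ 4 = q ^ 12" by (simp_all flip: power_mult)
  have cancel: "e1 \<noteq> 0 \<Longrightarrow> e2 \<noteq> 0 \<Longrightarrow> e3 \<noteq> 0 \<Longrightarrow> e4 \<noteq> 0 \<Longrightarrow> e6 \<noteq> 0 \<Longrightarrow> e12 \<noteq> 0 \<Longrightarrow>
     ((e2 ^ 3 * e3 ^ 6 * e12 ^ 3) / (e1 ^ 2 * e4 * e6 ^ 9)) ^ 2 * (e1 ^ 2 / e2)
        * (e6 ^ 5 / (e3 ^ 2 * e12 ^ 2)) ^ 3
      = e2 ^ 5 / (e1 ^ 2 * e4 ^ 2) * (e3 ^ 2 / e6) ^ 3" for e1 e2 e3 e4 e6 e12 :: complex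
    by (simp add: power_divide power_mult_distrib flip: power_mult,
        simp add: field_simps flip: power_add) (simp add: eval_nat_numeral)
  show ?thesis
    unfolding x_nome_def theta3_eta_quotient[OF q] theta3_eta_quotient[OF q3] pw
    by (rule cancel) (use q in \<open>simp_all add: euler_prod_nonzero euler_prod_power_nonzero\<close>)
qed

lemma Q_nome_theta:
  assumes q: "norm q < 1"
  shows "Q_nome q ^ 2 * theta3 q * psi q = q ^ 2 * theta3 (q ^ 3) ^ 3 * psi (q ^ 3) ^ 3"
proof -
  have q3: "norm (q ^ 3) < 1" using q by (simp add: norm_power_less_1)
  have pw: "(q ^ 3)\<^sup>2 = q ^ 6" "(q ^ 3) ^ 4 = q ^ 12" by (simp_all flip: power_mult)
  have cancel: "e1 \<noteq> 0 \<Longrightarrow> e2 \<noteq> 0 \<Longrightarrow> e3 \<noteq> 0 \<Longrightarrow> e4 \<noteq> 0 \<Longrightarrow> e6 \<noteq> 0 \<Longrightarrow> e12 \<noteq> 0 \<Longrightarrow>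
     (q * (e1 * e6 ^ 6) / (e2 ^ 2 * e3 ^ 3)) ^ 2 * (e2 ^ 5 / (e1 ^ 2 * e4 ^ 2)) * (e4 ^ 2 / e2)
      = q ^ 2 * (e6 ^ 5 / (e3 ^ 2 * e12 ^ 2)) ^ 3 * (e12 ^ 2 / e6) ^ 3"
    for e1 e2 e3 e4 e6 e12 :: complex
    by (simp add: power_divide power_mult_distrib flip: power_mult,
        simp add: field_simps flip: power_add) (simp add: eval_nat_numeral)
  show ?thesis
    unfolding Q_nome_def theta3_eta_quotient[OF q] theta3_eta_quotient[OF q3] psi_def pw
    by (rule cancel) (use q in \<open>simp_all add: euler_prod_nonzero euler_prod_power_nonzero\<close>)
qed

lemma theta3_minus_cube_deriv_0: "((\<lambda>q. theta3 (- (q ^ 3))) has_field_derivative 0) (at 0)"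
proof -
  have "((\<lambda>q :: complex. - (q ^ 3)) has_field_derivative 0) (at 0)"
    by (rule derivative_eq_intros refl | simp)+
  from holomorphic_chain_on_disc[OF holomorphic_theta3 _ this] show ?thesis by simp
qed

lemma deriv_x_nome_0: "deriv x_nome 0 = 2"
proof -
  have "2 * deriv x_nome 0 - 2 = 2"
  proof (rule deriv_eq_on_disc[of "\<lambda>q. x_nome q ^ 2 * theta3 (-q) * theta3 (q ^ 3) ^ 3"
        "\<lambda>q. theta3 q * theta3 (- (q ^ 3)) ^ 3" 0])
    show "((\<lambda>q. x_nome q ^ 2 * theta3 (-q) * theta3 (q ^ 3) ^ 3) has_field_derivative
        2 * deriv x_nome 0 - 2) (at 0)"
      by (rule derivative_eq_intros deriv_on_disc[OF holomorphic_x_nome] theta3_minus_deriv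
          theta3_power_deriv refl | simp add: deriv_theta3_0)+
    show "((\<lambda>q. theta3 q * theta3 (- (q ^ 3)) ^ 3) has_field_derivative 2) (at 0)"
      by (rule derivative_eq_intros theta3_deriv theta3_minus_cube_deriv_0 refl | simp add: deriv_theta3_0)+
  qed (use x_nome_theta in auto)
  then show ?thesis by simp
qed

text \<open>
  With \<open>r = b B / (a A)\<close> the definition of \<open>x\<close> makes \<open>B^4/A^4\<close> and \<open>b^4/a^4\<close> monomials in \<open>r\<close> and \<open>x\<close>. The fourth
  power of the cubic modular equation, \<open>(1 - r)^4 = (1 - b^4/a^4) (1 - B^4/A^4)\<close>, is then a quadratic equation
  for \<open>r\<close> over the rational functions in \<open>x\<close>. Its discriminant is a square, so it splits into linear factors
  that are exchanged by \<open>x \<mapsto> -x\<close>.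
\<close>

lemma modular_equation:
  assumes q: "norm q < 1"
  defines "r \<equiv> theta3 (-q) * theta3 (- (q ^ 3)) / (theta3 q * theta3 (q ^ 3))"
  shows "theta3 (- (q ^ 3)) ^ 4 = r * x_nome q ^ 2 * theta3 (q ^ 3) ^ 4" (is ?B)
    and "theta3 (-q) ^ 4 * x_nome q ^ 2 = r ^ 3 * theta3 q ^ 4" (is ?b)
    and "(r * (2 * x_nome q - 1) - x_nome q * (2 - x_nome q))
       * (r * (2 * x_nome q + 1) - x_nome q * (2 + x_nome q)) = 0" (is ?F)
proof -
  have q3: "norm (q ^ 3) < 1" using q by (simp add: norm_power_less_1)
  define a b A B X where "a = theta3 q" and "b = theta3 (-q)" and "A = theta3 (q ^ 3)"
    and "B = theta3 (- (q ^ 3))" and "X = x_nome q"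
  note defs = a_def b_def A_def B_def X_def
  have nz: "a \<noteq> 0" "b \<noteq> 0" "A \<noteq> 0" "B \<noteq> 0"
    using theta3_nonzero[OF q] theta3_nonzero[OF q3] theta3_nonzero[of "-q"]
      theta3_nonzero[of "-(q ^ 3)"] q q3 by (auto simp: defs)
  have r: "r * (a * A) = b * B" using nz by (simp add: r_def defs)
  then have r0: "r \<noteq> 0" using nz by auto
  have x: "X\<^sup>2 * b * A ^ 3 = a * B ^ 3"
    using x_nome_theta[OF q] by (simp add: defs)
  have "B ^ 4 * (a * b) = (r * X\<^sup>2 * A ^ 4) * (a * b)"
    using r x by algebra
  then have B: "B ^ 4 = r * X\<^sup>2 * A ^ 4" using nz by simp
  have "(b ^ 4 * X\<^sup>2) * (B * A ^ 3) = (r ^ 3 * a ^ 4) * (B * A ^ 3)"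
    using r x by algebra
  then have b: "b ^ 4 * X\<^sup>2 = r ^ 3 * a ^ 4" using nz by simp
  from B b show ?B ?b by (simp_all add: defs)
  have c: "(a * A - b * B) ^ 4 = (a ^ 4 - b ^ 4) * (A ^ 4 - B ^ 4)"
  proof -
    have "(a * A - b * B) ^ 4 = (16 * q * psi q ^ 4) * (16 * q ^ 3 * psi (q ^ 3) ^ 4)"
      unfolding defs theta3_cubic[OF q] by algebra
    then show ?thesis
      using jacobi_quartic[OF q] jacobi_quartic[OF q3] by (simp add: defs)
  qed
  have "a * A - b * B = (1 - r) * (a * A)" using r by (simp add: algebra_simps)
  with c have "((1 - r) * (a * A)) ^ 4 = (a ^ 4 - b ^ 4) * (A ^ 4 - B ^ 4)" by simp
  then have "((1 - r) * (a * A)) ^ 4 * X\<^sup>2 = (X\<^sup>2 * a ^ 4 - b ^ 4 * X\<^sup>2) * (A ^ 4 - B ^ 4)"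
    by algebra
  then have "((1 - r) ^ 4 * X\<^sup>2) * (a ^ 4 * A ^ 4) = ((X\<^sup>2 - r ^ 3) * (1 - r * X\<^sup>2)) * (a ^ 4 * A ^ 4)"
    using B b by algebra
  then have "(1 - r) ^ 4 * X\<^sup>2 = (X\<^sup>2 - r ^ 3) * (1 - r * X\<^sup>2)" using nz by simp
  then have "r * ((r * (2 * X - 1) - X * (2 - X)) * (r * (2 * X + 1) - X * (2 + X))) = 0"
    by algebra
  then show ?F using r0 by (simp add: X_def)
qed

text \<open>
  Both linear factors vanish at \<open>q = 0\<close>, where \<open>r = x = 1\<close>, but the second one has a non-zero derivative there.
  It is therefore non-zero near the origin, the first factor vanishes there, and by the identity theorem it
  vanishes on the disc.
\<close>

theorem modular_parametrization:
  assumes q: "norm q < 1"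
  shows "theta3 (-q) * theta3 (- (q ^ 3)) / (theta3 q * theta3 (q ^ 3)) * (2 * x_nome q - 1)
    = x_nome q * (2 - x_nome q)"
proof -
  define r where "r q = theta3 (-q) * theta3 (- (q ^ 3)) / (theta3 q * theta3 (q ^ 3))" for q
  define F1 where "F1 q = r q * (2 * x_nome q - 1) - x_nome q * (2 - x_nome q)" for q
  define F2 where "F2 q = r q * (2 * x_nome q + 1) - x_nome q * (2 + x_nome q)" for q
  have nz: "theta3 q * theta3 (q ^ 3) \<noteq> 0" if "norm q < 1" for q
    using theta3_nonzero[OF that] theta3_nonzero[of "q ^ 3"] norm_power_less_1[OF that, of 3] by simp
  have hr: "r holomorphic_on ball 0 1"
    unfolding r_def[abs_def]
    by (intro holomorphic_intros holomorphic_theta3 holomorphic_comp_uminus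
        holomorphic_comp_power[of _ 3] holomorphic_comp_power[of "\<lambda>q. theta3 (-q)" 3]) (use nz in auto)
  have hF1: "F1 holomorphic_on ball 0 1"
    unfolding F1_def[abs_def] by (intro holomorphic_intros hr holomorphic_x_nome)
  have F12: "F1 q * F2 q = 0" if "norm q < 1" for q
    using modular_equation(3)[OF that] by (simp add: F1_def F2_def r_def)
  have r0: "r 0 = 1" by (simp add: r_def)
  have dr: "(r has_field_derivative -4) (at 0)"
    unfolding r_def[abs_def]
    by (rule derivative_eq_intros theta3_deriv theta3_minus_deriv theta3_power_deriv theta3_minus_cube_deriv_0 refl
        | simp add: deriv_theta3_0)+
  \<comment> \<open>From \<open>r' = -4\<close> and \<open>x' = 2\<close> at the origin: \<open>F2' = 3 r' + 2 x' - 4 x' = -16\<close>.\<close>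
  have dF2: "(F2 has_field_derivative -16) (at 0)"
    unfolding F2_def[abs_def]
    by (rule derivative_eq_intros dr deriv_on_disc[OF holomorphic_x_nome] refl
        | simp add: deriv_x_nome_0 r0)+
  have "F2 0 = 0" by (simp add: F2_def r0)
  then have "((\<lambda>h. F2 h / h) \<longlongrightarrow> -16) (at 0)"
    using dF2 by (simp add: DERIV_def)
  then have "eventually (\<lambda>h. F2 h / h \<noteq> 0) (at 0)"
    by (rule tendsto_imp_eventually_ne) simp
  then obtain d where d: "d > 0" "\<And>h. h \<noteq> 0 \<Longrightarrow> norm h < d \<Longrightarrow> F2 h \<noteq> 0"
    by (auto simp: eventually_at dist_norm)
  have "F1 q = 0"
  proof (rule analytic_continuation_open[where s = "ball 0 (min d 1) - {0}" and s' = "ball 0 1"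
        and f = F1 and g = "\<lambda>_. 0"])
    have "of_real (min d 1 / 2) \<in> ball (0::complex) (min d 1) - {0}"
      using d(1) by (auto simp: norm_divide min_def)
    then show "ball (0::complex) (min d 1) - {0} \<noteq> {}" by blast
    fix z :: complex assume "z \<in> ball 0 (min d 1) - {0}"
    then show "F1 z = 0" using F12[of z] d(2)[of z] by auto
  qed (use hF1 q in auto)
  then show ?thesis by (simp add: F1_def r_def)
qed

text \<open>
  The parametrization turns the monomials in \<open>r\<close> and \<open>x\<close> into rational functions of \<open>x\<close>. It also shows that \<open>x\<close>
  omits \<open>1/2\<close>, because there the right-hand side \<open>x (2 - x)\<close> is \<open>3/4\<close>, and that it omits \<open>2\<close>, because \<open>r\<close> has no zero.
\<close>

lemma theta_quotients_in_x:
  assumes q: "norm q < 1" and X: "X = x_nome q"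
  shows "2 * X - 1 \<noteq> 0" "2 - X \<noteq> 0" "X \<noteq> 0"
    and "theta3 (- (q ^ 3)) ^ 4 * (2 * X - 1) = theta3 (q ^ 3) ^ 4 * (X ^ 3 * (2 - X))"
    and "theta3 (-q) ^ 4 * (2 * X - 1) ^ 3 = theta3 q ^ 4 * (X * (2 - X) ^ 3)"
proof -
  define r where "r = theta3 (-q) * theta3 (- (q ^ 3)) / (theta3 q * theta3 (q ^ 3))"
  have par: "r * (2 * X - 1) = X * (2 - X)"
    using modular_parametrization[OF q] by (simp add: r_def X)
  have me: "theta3 (- (q ^ 3)) ^ 4 = r * X ^ 2 * theta3 (q ^ 3) ^ 4"
    "theta3 (-q) ^ 4 * X ^ 2 = r ^ 3 * theta3 q ^ 4"
    using modular_equation[OF q] by (simp_all add: r_def X)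
  show X0: "X \<noteq> 0" using x_nome_nonzero[OF q] by (simp add: X)
  have r0: "r \<noteq> 0"
    using theta3_nonzero[OF q] theta3_nonzero[of "-q"] theta3_nonzero[of "q ^ 3"]
      theta3_nonzero[of "-(q ^ 3)"] q norm_power_less_1[OF q, of 3] by (simp add: r_def)
  show n1: "2 * X - 1 \<noteq> 0"
  proof
    assume "2 * X - 1 = 0"
    then have "X = 1 / 2" by (simp add: field_simps)
    with par show False by simp
  qed
  show "2 - X \<noteq> 0" using par r0 n1 by auto
  show "theta3 (- (q ^ 3)) ^ 4 * (2 * X - 1) = theta3 (q ^ 3) ^ 4 * (X ^ 3 * (2 - X))"
    using me(1) par by algebra
  have "(theta3 (-q) ^ 4 * (2 * X - 1) ^ 3) * X\<^sup>2 = (theta3 q ^ 4 * (X * (2 - X) ^ 3)) * X\<^sup>2"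
    using me(2) par by algebra
  then show "theta3 (-q) ^ 4 * (2 * X - 1) ^ 3 = theta3 q ^ 4 * (X * (2 - X) ^ 3)"
    using X0 by simp
qed

text \<open>
  The complementary quotients \<open>1 - B^4/A^4\<close> and \<open>1 - b^4/a^4\<close> also factor. Up to factors without zeros they are fourth
  powers of \<open>\<theta>\<^sub>2\<close>, which vanishes only at \<open>q = 0\<close>, so \<open>x\<close> omits \<open>1\<close> and \<open>-1\<close> elsewhere.
\<close>

lemma theta_quotient_complements_in_x:
  assumes q: "norm q < 1" and X: "X = x_nome q"
  shows "(theta3 (q ^ 3) ^ 4 - theta3 (- (q ^ 3)) ^ 4) * (2 * X - 1)
      = theta3 (q ^ 3) ^ 4 * ((X - 1) ^ 3 * (X + 1))"
    and "(theta3 q ^ 4 - theta3 (-q) ^ 4) * (2 * X - 1) ^ 3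
      = theta3 q ^ 4 * ((X - 1) * (X + 1) ^ 3)"
    and "q \<noteq> 0 \<Longrightarrow> X - 1 \<noteq> 0" "q \<noteq> 0 \<Longrightarrow> X + 1 \<noteq> 0"
proof -
  note p = theta_quotients_in_x[OF q X]
  show 1: "(theta3 (q ^ 3) ^ 4 - theta3 (- (q ^ 3)) ^ 4) * (2 * X - 1)
      = theta3 (q ^ 3) ^ 4 * ((X - 1) ^ 3 * (X + 1))"
    using p(4) by algebra
  show "(theta3 q ^ 4 - theta3 (-q) ^ 4) * (2 * X - 1) ^ 3
      = theta3 q ^ 4 * ((X - 1) * (X + 1) ^ 3)"
    using p(5) by algebra
  assume "q \<noteq> 0"
  have q3: "norm (q ^ 3) < 1" using q by (simp add: norm_power_less_1)
  have "theta3 (q ^ 3) ^ 4 - theta3 (- (q ^ 3)) ^ 4 \<noteq> 0"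
    unfolding jacobi_quartic[OF q3] using \<open>q \<noteq> 0\<close> psi_nonzero[OF q3] by simp
  then have "theta3 (q ^ 3) ^ 4 * ((X - 1) ^ 3 * (X + 1)) \<noteq> 0"
    unfolding 1[symmetric] using p(1) by simp
  then show "X - 1 \<noteq> 0" "X + 1 \<noteq> 0" by auto
qed

section \<open>Derivatives of the two eta quotients\<close>

lemma theta3_fourth_power_deriv:
  assumes "norm (g q) < 1" "q \<noteq> 0" "g q \<noteq> 0" "(g has_field_derivative k * g q / q) (at q)"
  shows "((\<lambda>q. theta3 (g q) ^ 4) has_field_derivative
    2 * k * ld_theta (g q) * theta3 (g q) ^ 4 / q) (at q)"
proof -
  have der: "((\<lambda>q. theta3 (g q) ^ 4) has_field_derivative
      4 * theta3 (g q) ^ 3 * (deriv theta3 (g q) * (k * g q / q))) (at q)"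
    using DERIV_power[OF holomorphic_chain_on_disc[OF holomorphic_theta3 assms(1,4)], of 4]
    by (simp add: mult_ac)
  have "4 * theta3 (g q) ^ 3 * (deriv theta3 (g q) * (k * g q / q))
      = 2 * k * theta3 (g q) ^ 3 * (2 * (g q * deriv theta3 (g q))) / q"
    by simp
  also have "\<dots> = 2 * k * ld_theta (g q) * theta3 (g q) ^ 4 / q"
    unfolding ld_theta_eq[OF assms(1)] by (simp add: eval_nat_numeral)
  finally show ?thesis using der by (simp only:)
qed

lemma theta3_fourth_powers_deriv:
  assumes "norm q < 1" "q \<noteq> 0"
  shows "((\<lambda>q. theta3 q ^ 4) has_field_derivative 2 * ld_theta q * theta3 q ^ 4 / q) (at q)"
    "((\<lambda>q. theta3 (-q) ^ 4) has_field_derivative 2 * ld_theta (-q) * theta3 (-q) ^ 4 / q) (at q)"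
    "((\<lambda>q. theta3 (q ^ 3) ^ 4) has_field_derivative
      6 * ld_theta (q ^ 3) * theta3 (q ^ 3) ^ 4 / q) (at q)"
    "((\<lambda>q. theta3 (- (q ^ 3)) ^ 4) has_field_derivative
      6 * ld_theta (- (q ^ 3)) * theta3 (- (q ^ 3)) ^ 4 / q) (at q)"
proof -
  have d: "((\<lambda>q. q) has_field_derivative 1 * q / q) (at q)"
    "((\<lambda>q. - q) has_field_derivative 1 * - q / q) (at q)"
    "((\<lambda>q. q ^ 3) has_field_derivative 3 * q ^ 3 / q) (at q)"
    "((\<lambda>q. - (q ^ 3)) has_field_derivative 3 * - (q ^ 3) / q) (at q)"
    using assms(2) by (auto intro!: derivative_eq_intros simp: power3_eq_cube power2_eq_square)
  have n: "norm (q ^ 3) < 1" using assms by (simp add: norm_power_less_1)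
  show "((\<lambda>q. theta3 q ^ 4) has_field_derivative 2 * ld_theta q * theta3 q ^ 4 / q) (at q)"
    using theta3_fourth_power_deriv[OF _ _ _ d(1)] assms by simp
  show "((\<lambda>q. theta3 (-q) ^ 4) has_field_derivative 2 * ld_theta (-q) * theta3 (-q) ^ 4 / q) (at q)"
    using theta3_fourth_power_deriv[OF _ _ _ d(2)] assms by simp
  show "((\<lambda>q. theta3 (q ^ 3) ^ 4) has_field_derivative
      6 * ld_theta (q ^ 3) * theta3 (q ^ 3) ^ 4 / q) (at q)"
    using theta3_fourth_power_deriv[OF _ _ _ d(3)] assms n by simp
  show "((\<lambda>q. theta3 (- (q ^ 3)) ^ 4) has_field_derivative
      6 * ld_theta (- (q ^ 3)) * theta3 (- (q ^ 3)) ^ 4 / q) (at q)"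
    using theta3_fourth_power_deriv[OF _ _ _ d(4)] assms n by simp
qed

text \<open>
  The rational expressions for \<open>B^4/A^4\<close> and \<open>b^4/a^4\<close> are differentiated; the logarithmic derivatives on the
  theta side are known from \<open>ld_theta_diff\<close> at \<open>q\<^sup>3\<close> and at \<open>q\<close>. This determines \<open>D x\<close> in two ways, in terms of
  \<open>A^4\<close> and of \<open>a^4\<close>; the comparison yields the multiplier \<open>a^4/A^4 = (2 x - 1)\<^sup>2\<close>.
\<close>

lemma x_nome_deriv_theta:
  assumes q: "norm q < 1" "q \<noteq> 0" and X: "X = x_nome q"
  defines "dX \<equiv> q * deriv x_nome q"
  shows "2 * dX = X * (2 - X) * (X\<^sup>2 - 1) * theta3 (q ^ 3) ^ 4"
    and "2 * dX * (2 * X - 1)\<^sup>2 = X * (2 - X) * (X\<^sup>2 - 1) * theta3 q ^ 4"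
proof -
  have q3: "norm (q ^ 3) < 1" using q by (simp add: norm_power_less_1)
  note p = theta_quotients_in_x[OF q(1) X] and pd = theta_quotient_complements_in_x[OF q(1) X]
  have nz: "X - 1 \<noteq> 0" "X + 1 \<noteq> 0" using pd q by auto
  note xd = deriv_on_disc[OF holomorphic_x_nome q(1)] and td = theta3_fourth_powers_deriv[OF q]
  define x' where "x' = deriv x_nome q"
  have dX: "x' = dX / q" using q(2) by (simp add: x'_def dX_def)
  define k where "k = inverse q"
  have kq: "k * q = 1" and k: "y / q = y * k" for y
    using q(2) by (simp_all add: k_def divide_inverse)
  define A4 B4 a4 b4 where "A4 = theta3 (q ^ 3) ^ 4" and "B4 = theta3 (- (q ^ 3)) ^ 4"
    and "a4 = theta3 q ^ 4" and "b4 = theta3 (-q) ^ 4"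
  note defs = A4_def B4_def a4_def b4_def
  define M N m n where "M = ld_theta (q ^ 3)" and "N = ld_theta (- (q ^ 3))"
    and "m = ld_theta q" and "n = ld_theta (-q)"
  note ldefs = M_def N_def m_def n_def
  have A0: "A4 \<noteq> 0" "a4 \<noteq> 0" using theta3_nonzero[OF q3] theta3_nonzero[OF q(1)] by (simp_all add: defs)
  have MN: "2 * (M - N) = A4 - B4" using ld_theta_diff[OF q3] by (simp add: defs ldefs mult.commute)
  have mn: "2 * (m - n) = a4 - b4" using ld_theta_diff[OF q(1)] by (simp add: defs ldefs mult.commute)
  have "6 * N * B4 / q * (2 * X - 1) + B4 * (2 * x')
      = 6 * M * A4 / q * (X ^ 3 * (2 - X)) + A4 * (3 * X\<^sup>2 * x' * (2 - X) - X ^ 3 * x')"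
  proof (rule deriv_eq_on_disc[of "\<lambda>q. theta3 (- (q ^ 3)) ^ 4 * (2 * x_nome q - 1)"
        "\<lambda>q. theta3 (q ^ 3) ^ 4 * (x_nome q ^ 3 * (2 - x_nome q))" q])
    show "((\<lambda>q. theta3 (- (q ^ 3)) ^ 4 * (2 * x_nome q - 1)) has_field_derivative
        6 * N * B4 / q * (2 * X - 1) + B4 * (2 * x')) (at q)"
      unfolding defs ldefs x'_def X
      by (rule derivative_eq_intros xd td refl | simp)+
    show "((\<lambda>q. theta3 (q ^ 3) ^ 4 * (x_nome q ^ 3 * (2 - x_nome q))) has_field_derivative
        6 * M * A4 / q * (X ^ 3 * (2 - X)) + A4 * (3 * X\<^sup>2 * x' * (2 - X) - X ^ 3 * x')) (at q)"
      unfolding defs ldefs x'_def X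
      by (rule derivative_eq_intros xd td refl | simp)+
  qed (use theta_quotients_in_x(4)[OF _ refl] q in auto)
  then have e: "6 * N * B4 * (2 * X - 1) + B4 * (2 * dX)
      = 6 * M * A4 * (X ^ 3 * (2 - X)) + A4 * (3 * X\<^sup>2 * dX * (2 - X) - X ^ 3 * dX)"
    unfolding dX k using kq by algebra
  have pB: "B4 * (2 * X - 1) = A4 * (X ^ 3 * (2 - X))" using p(4) by (simp add: defs)
  have pA: "(A4 - B4) * (2 * X - 1) = A4 * ((X - 1) ^ 3 * (X + 1))" using pd(1) by (simp add: defs)
  have "dX * (A4 * (6 * X\<^sup>2 * (X - 1)\<^sup>2)) = dX * (2 * B4 - A4 * (6 * X\<^sup>2 - 4 * X ^ 3)) * (2 * X - 1)"
    using pB by algebra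
  also have "\<dots> = 3 * ((A4 - B4) * (2 * X - 1)) * (B4 * (2 * X - 1))"
    using e pB MN by algebra
  also have "\<dots> = (X * (2 - X) * (X\<^sup>2 - 1) * A4) * (A4 * (3 * X\<^sup>2 * (X - 1)\<^sup>2))"
    unfolding pB pA by algebra
  finally have "(2 * dX) * (A4 * (3 * X\<^sup>2 * (X - 1)\<^sup>2))
      = (X * (2 - X) * (X\<^sup>2 - 1) * A4) * (A4 * (3 * X\<^sup>2 * (X - 1)\<^sup>2))"
    by simp
  then show 1: "2 * dX = X * (2 - X) * (X\<^sup>2 - 1) * theta3 (q ^ 3) ^ 4"
    using A0 p nz by (simp add: defs)
  have "2 * n * b4 / q * (2 * X - 1) ^ 3 + b4 * (3 * (2 * X - 1)\<^sup>2 * (2 * x'))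
      = 2 * m * a4 / q * (X * (2 - X) ^ 3) + a4 * (x' * (2 - X) ^ 3 - X * (3 * (2 - X)\<^sup>2 * x'))"
  proof (rule deriv_eq_on_disc[of "\<lambda>q. theta3 (-q) ^ 4 * (2 * x_nome q - 1) ^ 3"
        "\<lambda>q. theta3 q ^ 4 * (x_nome q * (2 - x_nome q) ^ 3)" q])
    show "((\<lambda>q. theta3 (-q) ^ 4 * (2 * x_nome q - 1) ^ 3) has_field_derivative
        2 * n * b4 / q * (2 * X - 1) ^ 3 + b4 * (3 * (2 * X - 1)\<^sup>2 * (2 * x'))) (at q)"
      unfolding defs ldefs x'_def X
      by (rule derivative_eq_intros xd td refl | simp)+
    show "((\<lambda>q. theta3 q ^ 4 * (x_nome q * (2 - x_nome q) ^ 3)) has_field_derivative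
        2 * m * a4 / q * (X * (2 - X) ^ 3) + a4 * (x' * (2 - X) ^ 3 - X * (3 * (2 - X)\<^sup>2 * x'))) (at q)"
      unfolding defs ldefs x'_def X
      by (rule derivative_eq_intros xd td refl | simp)+
  qed (use theta_quotients_in_x(5)[OF _ refl] q in auto)
  then have e: "2 * n * b4 * (2 * X - 1) ^ 3 + b4 * (3 * (2 * X - 1)\<^sup>2 * (2 * dX))
      = 2 * m * a4 * (X * (2 - X) ^ 3) + a4 * (dX * (2 - X) ^ 3 - X * (3 * (2 - X)\<^sup>2 * dX))"
    unfolding dX k using kq by algebra
  have pb: "b4 * (2 * X - 1) ^ 3 = a4 * (X * (2 - X) ^ 3)" using p(5) by (simp add: defs)
  have pa: "(a4 - b4) * (2 * X - 1) ^ 3 = a4 * ((X - 1) * (X + 1) ^ 3)" using pd(2) by (simp add: defs)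
  have "(2 * dX * (2 * X - 1)\<^sup>2) * (a4 * ((2 - X)\<^sup>2 * (X + 1)\<^sup>2))
      = dX * (6 * b4 * (2 * X - 1)\<^sup>2 - a4 * (2 - X)\<^sup>2 * (2 - 4 * X)) * (2 * X - 1) ^ 3"
    using pb by algebra
  also have "\<dots> = ((a4 - b4) * (2 * X - 1) ^ 3) * (b4 * (2 * X - 1) ^ 3)"
    using e pb mn by algebra
  also have "\<dots> = (X * (2 - X) * (X\<^sup>2 - 1) * a4) * (a4 * ((2 - X)\<^sup>2 * (X + 1)\<^sup>2))"
    unfolding pb pa by algebra
  finally show "2 * dX * (2 * X - 1)\<^sup>2 = X * (2 - X) * (X\<^sup>2 - 1) * theta3 q ^ 4"
    using A0 p nz by (simp add: defs)
qed

text \<open>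
  Raising the theta quotient for \<open>Q\<^sup>2\<close> to the fourth power turns each \<open>psi\<close> into a difference of fourth powers
  of theta functions, hence into a rational function of \<open>x\<close> times \<open>A^4\<close> or \<open>a^4\<close>.
\<close>

lemma Q_nome_eighth_power:
  assumes q: "norm q < 1" "q \<noteq> 0" and X: "X = x_nome q"
  shows "256 * Q_nome q ^ 8 * (2 * X - 1) ^ 4 = (theta3 (q ^ 3) ^ 4) ^ 4 * (X - 1) ^ 8"
proof -
  have q3: "norm (q ^ 3) < 1" using q by (simp add: norm_power_less_1)
  note p = theta_quotients_in_x[OF q(1) X] and pd = theta_quotient_complements_in_x[OF q(1) X]
  have nz: "X - 1 \<noteq> 0" "X + 1 \<noteq> 0" using pd q by auto
  define A4 B4 a4 b4 where "A4 = theta3 (q ^ 3) ^ 4" and "B4 = theta3 (- (q ^ 3)) ^ 4"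
    and "a4 = theta3 q ^ 4" and "b4 = theta3 (-q) ^ 4"
  note defs = A4_def B4_def a4_def b4_def
  have A0: "A4 \<noteq> 0" "a4 \<noteq> 0" using theta3_nonzero[OF q3] theta3_nonzero[OF q(1)] by (simp_all add: defs)
  have "X * (2 - X) * (X\<^sup>2 - 1) \<noteq> 0"
  proof -
    have "X\<^sup>2 - 1 = (X - 1) * (X + 1)" by algebra
    then show ?thesis using p nz by simp
  qed
  moreover have "(X * (2 - X) * (X\<^sup>2 - 1)) * a4 = (X * (2 - X) * (X\<^sup>2 - 1)) * (A4 * (2 * X - 1)\<^sup>2)"
    using x_nome_deriv_theta[OF q X] unfolding defs by algebra
  ultimately have aA: "a4 = A4 * (2 * X - 1)\<^sup>2" by simp
  have "(Q_nome q ^ 2 * theta3 q * psi q) ^ 4 = (q ^ 2 * theta3 (q ^ 3) ^ 3 * psi (q ^ 3) ^ 3) ^ 4"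
    unfolding Q_nome_theta[OF q(1)] ..
  then have "Q_nome q ^ 8 * a4 * psi q ^ 4 = q ^ 8 * A4 ^ 3 * (psi (q ^ 3) ^ 4) ^ 3"
    by (simp add: defs power_mult_distrib flip: power_mult)
  then have "256 * Q_nome q ^ 8 * a4 * (16 * q * psi q ^ 4) = A4 ^ 3 * (16 * q ^ 3 * psi (q ^ 3) ^ 4) ^ 3"
    by algebra
  then have "256 * Q_nome q ^ 8 * a4 * (a4 - b4) = A4 ^ 3 * (A4 - B4) ^ 3"
    using jacobi_quartic[OF q(1)] jacobi_quartic[OF q3] by (simp add: defs)
  then have "256 * Q_nome q ^ 8 * a4 * ((a4 - b4) * (2 * X - 1) ^ 3)
      = A4 ^ 3 * ((A4 - B4) * (2 * X - 1)) ^ 3"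
    by algebra
  then have "256 * Q_nome q ^ 8 * a4 * (a4 * ((X - 1) * (X + 1) ^ 3))
      = A4 ^ 3 * (A4 * ((X - 1) ^ 3 * (X + 1))) ^ 3"
    using pd(1,2) by (simp add: defs)
  then have "(256 * Q_nome q ^ 8 * (2 * X - 1) ^ 4) * (A4 ^ 2 * ((X - 1) * (X + 1) ^ 3))
      = (A4 ^ 4 * (X - 1) ^ 8) * (A4 ^ 2 * ((X - 1) * (X + 1) ^ 3))"
    unfolding aA by algebra
  then show ?thesis using A0 nz by (simp add: defs)
qed

text \<open>
  The logarithmic derivative of \<open>256 Q^8 (2 x - 1)^4 = A^16 (x - 1)^8\<close>; the common value of both sides is
  cancelled in the end.
\<close>

lemma Q_nome_deriv:
  assumes q: "norm q < 1" "q \<noteq> 0" and X: "X = x_nome q"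
  shows "q * deriv Q_nome q = Q_nome q * (3 * ld_theta (q ^ 3)
    + X\<^sup>2 * (2 - X) * (X + 1) / (2 * (2 * X - 1)) * theta3 (q ^ 3) ^ 4)"
proof -
  note p = theta_quotients_in_x[OF q(1) X] and pd = theta_quotient_complements_in_x[OF q(1) X]
  have nz: "X - 1 \<noteq> 0" "X + 1 \<noteq> 0" using pd q by auto
  have q3: "norm (q ^ 3) < 1" using q by (simp add: norm_power_less_1)
  note xd = deriv_on_disc[OF holomorphic_x_nome q(1)] and Qd = deriv_on_disc[OF holomorphic_Q_nome q(1)]
    and td = theta3_fourth_powers_deriv(3)[OF q]
  define x' Q' Q A4 M where "x' = deriv x_nome q" and "Q' = deriv Q_nome q" and "Q = Q_nome q"
    and "A4 = theta3 (q ^ 3) ^ 4" and "M = ld_theta (q ^ 3)"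
  note defs = x'_def Q'_def Q_def A4_def M_def
  have A0: "A4 \<noteq> 0" using theta3_nonzero[OF q3] by (simp add: defs)
  have Q0: "Q \<noteq> 0" using Q_nome_nonzero[OF q] by (simp add: defs)
  have "256 * (8 * Q ^ 7 * Q') * (2 * X - 1) ^ 4 + 256 * Q ^ 8 * (4 * (2 * X - 1) ^ 3 * (2 * x'))
      = 4 * A4 ^ 3 * (6 * M * A4 / q) * (X - 1) ^ 8 + A4 ^ 4 * (8 * (X - 1) ^ 7 * x')"
  proof (rule DERIV_unique)
    show "((\<lambda>q. 256 * Q_nome q ^ 8 * (2 * x_nome q - 1) ^ 4) has_field_derivative
        256 * (8 * Q ^ 7 * Q') * (2 * X - 1) ^ 4 + 256 * Q ^ 8 * (4 * (2 * X - 1) ^ 3 * (2 * x'))) (at q)"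
      unfolding defs X by (rule derivative_eq_intros xd Qd refl | simp)+
    have "((\<lambda>q. (theta3 (q ^ 3) ^ 4) ^ 4 * (x_nome q - 1) ^ 8) has_field_derivative
        4 * A4 ^ 3 * (6 * M * A4 / q) * (X - 1) ^ 8 + A4 ^ 4 * (8 * (X - 1) ^ 7 * x')) (at q)"
      unfolding defs X by (rule derivative_eq_intros xd td refl | simp)+
    then show "((\<lambda>q. 256 * Q_nome q ^ 8 * (2 * x_nome q - 1) ^ 4) has_field_derivative
        4 * A4 ^ 3 * (6 * M * A4 / q) * (X - 1) ^ 8 + A4 ^ 4 * (8 * (X - 1) ^ 7 * x')) (at q)"
      by (rule has_field_derivative_transform_within_open[where S = "ball 0 1 - {0}"])
         (use q Q_nome_eighth_power[OF _ _ refl] in auto)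
  qed
  note e = this
  define k where "k = inverse q"
  have kq: "k * q = 1" and k: "y / q = y * k" for y
    using q(2) by (simp_all add: k_def divide_inverse)
  define K where "K = A4 ^ 4 * (X - 1) ^ 8"
  have K0: "K \<noteq> 0" using A0 nz by (simp add: K_def)
  have K: "256 * Q ^ 8 * (2 * X - 1) ^ 4 = K"
    using Q_nome_eighth_power[OF q X] by (simp add: K_def defs)
  define dQ dX where "dQ = q * Q'" and "dX = q * x'"
  have e': "256 * (8 * Q ^ 7 * dQ) * (2 * X - 1) ^ 4 + 256 * Q ^ 8 * (4 * (2 * X - 1) ^ 3 * (2 * dX))
      = 4 * A4 ^ 3 * (6 * M * A4) * (X - 1) ^ 8 + A4 ^ 4 * (8 * (X - 1) ^ 7 * dX)"
    using e kq unfolding k dQ_def dX_def by algebra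
  have "(256 * (8 * Q ^ 7 * dQ) * (2 * X - 1) ^ 4 + 256 * Q ^ 8 * (4 * (2 * X - 1) ^ 3 * (2 * dX)))
        * (Q * (2 * X - 1) * (X - 1))
      = 8 * (256 * Q ^ 8 * (2 * X - 1) ^ 4) * (dQ * (2 * X - 1) * (X - 1) + dX * Q * (X - 1))"
    by algebra
  moreover have "(4 * A4 ^ 3 * (6 * M * A4) * (X - 1) ^ 8 + A4 ^ 4 * (8 * (X - 1) ^ 7 * dX))
        * (Q * (2 * X - 1) * (X - 1))
      = 8 * K * (Q * (3 * M * (2 * X - 1) * (X - 1) + dX * (2 * X - 1)))"
    unfolding K_def by algebra
  ultimately have "(8 * K) * (dQ * (2 * X - 1) * (X - 1) + dX * Q * (X - 1))
      = (8 * K) * (Q * (3 * M * (2 * X - 1) * (X - 1) + dX * (2 * X - 1)))"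
    unfolding e' K by (simp only:)
  moreover have "8 * K \<noteq> 0" using K0 by simp
  ultimately have "dQ * (2 * X - 1) * (X - 1) + dX * Q * (X - 1)
      = Q * (3 * M * (2 * X - 1) * (X - 1) + dX * (2 * X - 1))"
    using mult_left_cancel by blast
  moreover have "2 * dX = X * (2 - X) * (X\<^sup>2 - 1) * A4"
    using x_nome_deriv_theta(1)[OF q X] by (simp add: defs dX_def)
  ultimately have "(2 * dQ * (2 * X - 1)) * (X - 1)
      = (Q * (6 * M * (2 * X - 1) + X\<^sup>2 * (2 - X) * (X + 1) * A4)) * (X - 1)"
    by algebra
  then have "2 * dQ * (2 * X - 1) = Q * (6 * M * (2 * X - 1) + X\<^sup>2 * (2 - X) * (X + 1) * A4)"
    using nz by simp
  moreover have "Q * (6 * M * (2 * X - 1) + X\<^sup>2 * (2 - X) * (X + 1) * A4)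
      = (Q * (3 * M + X\<^sup>2 * (2 - X) * (X + 1) / (2 * (2 * X - 1)) * A4)) * (2 * (2 * X - 1))"
  proof -
    have "w / (2 * (2 * X - 1)) * A4 * (2 * (2 * X - 1)) = w * A4" for w
      using p(1) by simp
    then show ?thesis by (simp only: distrib_left distrib_right mult.assoc) (simp add: algebra_simps)
  qed
  ultimately have "dQ * (2 * (2 * X - 1))
      = (Q * (3 * M + X\<^sup>2 * (2 - X) * (X + 1) / (2 * (2 * X - 1)) * A4)) * (2 * (2 * X - 1))"
    by (simp add: mult_ac)
  then have "dQ = Q * (3 * M + X\<^sup>2 * (2 - X) * (X + 1) / (2 * (2 * X - 1)) * A4)"
    using p(1) by simp
  then show ?thesis by (simp add: dQ_def defs)
qed

section \<open>The differential equation\<close>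

text \<open>
  From \<open>P Q' = Q (t + W)\<close> and \<open>P t' = c - t\<^sup>2\<close> one gets
  \<open>P\<^sup>2 Q'' = Q ((t + W)\<^sup>2 + c - t\<^sup>2 + P W' - P' (t + W))\<close>. The square of \<open>t\<close> cancels, and the term linear in \<open>t\<close> is
  absorbed by \<open>P (2 W - P') Q'\<close>. What remains are two identities between rational functions: the
  coefficients of \<open>Q'\<close> and \<open>Q\<close> in the equation are \<open>(P' - 2 W) / P\<close> and \<open>(W\<^sup>2 - c - P W') / P\<^sup>2\<close>.
\<close>

lemma riccati_imp_ode:
  fixes Q t :: "complex \<Rightarrow> complex" and U :: "complex set"
  defines "P \<equiv> \<lambda>z. z * (2 - z) * (z\<^sup>2 - 1) / 2"
    and "W \<equiv> \<lambda>z. z\<^sup>2 * (2 - z) * (z + 1) / (2 * (2 * z - 1))"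
    and "c \<equiv> \<lambda>z. 9 / 4 * (z ^ 3 * (2 - z) * (z - 1) ^ 3 * (z + 1)) / (2 * z - 1)\<^sup>2"
  assumes U: "open U"
    and nz: "\<And>z. z \<in> U \<Longrightarrow> z \<noteq> 0 \<and> 2 - z \<noteq> 0 \<and> z - 1 \<noteq> 0 \<and> z + 1 \<noteq> 0 \<and> 2 * z - 1 \<noteq> 0"
    and Q: "\<And>z. z \<in> U \<Longrightarrow> (Q has_field_derivative Q z * (t z + W z) / P z) (at z)"
    and t: "\<And>z. z \<in> U \<Longrightarrow> (t has_field_derivative (c z - (t z)\<^sup>2) / P z) (at z)"
    and x: "x \<in> U"
  shows "deriv (deriv Q) x
        + (1 / x - 1 / (x - 1) + 1 / (x + 1) + 1 / (x - 2) + 1 / (x - 1 / 2)) * deriv Q x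
        + 2 * (x ^ 2 - x + 1) / ((x - 1) ^ 2 * (x + 1) * (2 * x - 1)) * Q x = 0"
proof -
  note n = nz[OF x]
  have n': "x - 2 \<noteq> 0" "x - 1 / 2 \<noteq> 0" "x\<^sup>2 - 1 \<noteq> 0"
  proof -
    show "x - 2 \<noteq> 0" using n by auto
    show "x - 1 / 2 \<noteq> 0"
    proof
      assume "x - 1 / 2 = 0"
      then have "x = 1 / 2" by simp
      with n show False by simp
    qed
    have "x\<^sup>2 - 1 = (x - 1) * (x + 1)" by algebra
    then show "x\<^sup>2 - 1 \<noteq> 0" using n by simp
  qed
  have P0: "P x \<noteq> 0" using n n' by (simp add: P_def)
  define P' where "P' = 3 * x\<^sup>2 - 1 - 2 * x ^ 3 + x"
  define W' where "W' = ((4 * x + 3 * x\<^sup>2 - 4 * x ^ 3) * (2 * x - 1) - 2 * (x\<^sup>2 * (2 - x) * (x + 1)))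
    / (2 * (2 * x - 1)\<^sup>2)"
  have dP: "(P has_field_derivative P') (at x)"
    unfolding P_def P'_def
    by (rule derivative_eq_intros refl | simp)+ (simp add: field_simps power2_eq_square power3_eq_cube)
  have dW: "(W has_field_derivative W') (at x)"
    unfolding W_def W'_def using n
    by (auto intro!: derivative_eq_intros simp: divide_simps) algebra
  have D1: "deriv Q z = Q z * (t z + W z) / P z" if "z \<in> U" for z
    using Q[OF that] by (rule DERIV_imp_deriv)
  let ?S = "t x + W x"
  have "((\<lambda>z. Q z * (t z + W z) / P z) has_field_derivative
      ((Q x * ?S / P x * ?S + Q x * ((c x - (t x)\<^sup>2) / P x + W')) * P x - Q x * ?S * P') / (P x * P x)) (at x)"
    using P0 by (auto intro!: derivative_eq_intros Q[OF x] t[OF x] dP dW)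
  then have "(deriv Q has_field_derivative
      ((Q x * ?S / P x * ?S + Q x * ((c x - (t x)\<^sup>2) / P x + W')) * P x - Q x * ?S * P') / (P x * P x)) (at x)"
    by (rule has_field_derivative_transform_within_open[OF _ U x]) (simp add: D1)
  then have "deriv (deriv Q) x
      = ((Q x * ?S / P x * ?S + Q x * ((c x - (t x)\<^sup>2) / P x + W')) * P x - Q x * ?S * P') / (P x * P x)"
    by (rule DERIV_imp_deriv)
  also have "(Q x * ?S / P x * ?S + Q x * ((c x - (t x)\<^sup>2) / P x + W')) * P x
      = Q x * (?S\<^sup>2 + (c x - (t x)\<^sup>2) + W' * P x)"
    using P0 by (simp add: field_simps power2_eq_square)
  finally have D2: "deriv (deriv Q) x * (P x)\<^sup>2
      = Q x * (?S\<^sup>2 + (c x - (t x)\<^sup>2) + W' * P x) - Q x * ?S * P'"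
    using P0 by (simp add: power2_eq_square)
  have D1x: "deriv Q x * P x = Q x * ?S" using D1[OF x] P0 by simp
  define p1 where "p1 = 1 / x - 1 / (x - 1) + 1 / (x + 1) + 1 / (x - 2) + 1 / (x - 1 / 2)"
  define p0 where "p0 = 2 * (x ^ 2 - x + 1) / ((x - 1) ^ 2 * (x + 1) * (2 * x - 1))"
  have p1: "p1 * P x = P' - 2 * W x"
  proof -
    have "1 / (x - 1 / 2) = 2 / (2 * x - 1)" using n n' by (simp add: field_simps)
    then show ?thesis
      unfolding p1_def P_def P'_def W_def using n n' by (simp add: divide_simps) algebra
  qed
  have p0: "p0 * (P x)\<^sup>2 = (W x)\<^sup>2 - c x - W' * P x"
    unfolding p0_def P_def W_def c_def W'_def using n n' by (simp add: divide_simps) algebra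
  have "(deriv (deriv Q) x + p1 * deriv Q x + p0 * Q x) * (P x)\<^sup>2 = 0"
    using D2 D1x p1 p0 by algebra
  then have "deriv (deriv Q) x + p1 * deriv Q x + p0 * Q x = 0" using P0 by simp
  then show ?thesis by (simp only: p1_def p0_def)
qed

lemma dedekind_eta_in_nome:
  "dedekind_eta (of_nat k * \<tau> / 2)
    = exp (of_real pi * \<i> * \<tau> / 24) ^ k * euler_prod (exp (of_real pi * \<i> * \<tau>) ^ k)"
proof -
  have "exp (2 * of_real pi * \<i> * (of_nat k * \<tau> / 2) / 24) = exp (of_real pi * \<i> * \<tau> / 24) ^ k"
    unfolding exp_of_nat_mult[symmetric] by (rule arg_cong[where f = exp]) simp
  moreover have "exp (2 * of_real pi * \<i> * of_nat (Suc n) * (of_nat k * \<tau> / 2))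
      = (exp (of_real pi * \<i> * \<tau>) ^ k) ^ Suc n" for n
    unfolding exp_of_nat_mult[symmetric] by (rule arg_cong[where f = exp]) simp
  ultimately show ?thesis
    by (simp only: dedekind_eta_def euler_prod_def)
qed

lemma eta_quotients_in_nome:
  shows "x_tau \<tau> = x_nome (exp (of_real pi * \<i> * \<tau>))"
    and "Q_tau \<tau> = Q_nome (exp (of_real pi * \<i> * \<tau>))"
proof -
  let ?q = "exp (of_real pi * \<i> * \<tau>)"
  define e where "e = exp (of_real pi * \<i> * \<tau> / 24)"
  have e0: "e \<noteq> 0" by (simp add: e_def)
  have e24: "e ^ 24 = ?q"
    unfolding e_def exp_of_nat_mult[symmetric] by simp
  have eta: "dedekind_eta (\<tau> / 2) = e * euler_prod ?q"
    "dedekind_eta \<tau> = e ^ 2 * euler_prod (?q\<^sup>2)"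
    "dedekind_eta (3 * \<tau> / 2) = e ^ 3 * euler_prod (?q ^ 3)"
    "dedekind_eta (2 * \<tau>) = e ^ 4 * euler_prod (?q ^ 4)"
    "dedekind_eta (3 * \<tau>) = e ^ 6 * euler_prod (?q ^ 6)"
    "dedekind_eta (6 * \<tau>) = e ^ 12 * euler_prod (?q ^ 12)"
    using dedekind_eta_in_nome[of 1 \<tau>] dedekind_eta_in_nome[of 2 \<tau>] dedekind_eta_in_nome[of 3 \<tau>]
      dedekind_eta_in_nome[of 4 \<tau>] dedekind_eta_in_nome[of 6 \<tau>] dedekind_eta_in_nome[of 12 \<tau>]
    by (simp_all add: e_def)
  have x: "(e ^ 2 * y2) ^ 3 * (e ^ 3 * y3) ^ 6 * (e ^ 12 * y12) ^ 3 = e ^ 60 * (y2 ^ 3 * y3 ^ 6 * y12 ^ 3)"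
    "(e * y1) ^ 2 * (e ^ 4 * y4) * (e ^ 6 * y6) ^ 9 = e ^ 60 * (y1 ^ 2 * y4 * y6 ^ 9)"
    for y1 y2 y3 y4 y6 y12 by algebra+
  show "x_tau \<tau> = x_nome ?q"
    unfolding x_tau_def x_nome_def eta x using e0 by simp
  have Q: "(e * y1) * (e ^ 6 * y6) ^ 6 = e ^ 13 * (e ^ 24 * (y1 * y6 ^ 6))"
    "(e ^ 2 * y2) ^ 2 * (e ^ 3 * y3) ^ 3 = e ^ 13 * (y2 ^ 2 * y3 ^ 3)"
    for y1 y2 y3 y6 by algebra+
  show "Q_tau \<tau> = Q_nome ?q"
    unfolding Q_tau_def Q_nome_def eta Q using e0 by (simp add: e24)
qed

text \<open>
  Since \<open>X (h w) = w\<close>, the derivative along the local inverse \<open>h\<close> is \<open>d/dx = D / D X\<close>. Derivatives in the nome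
  are written as \<open>D F / q\<close> to match this.
\<close>

lemma has_field_derivative_over_inverse:
  fixes F h :: "complex \<Rightarrow> complex"
  assumes F: "(F has_field_derivative F' / h z) (at (h z))"
    and h: "(h has_field_derivative h') (at z)" "h z \<noteq> 0"
    and X: "(X has_field_derivative X' / h z) (at (h z))"
    and U: "open U" "z \<in> U" and inv: "\<And>w. w \<in> U \<Longrightarrow> X (h w) = w"
  shows "((\<lambda>w. F (h w)) has_field_derivative F' / X') (at z)"
proof -
  have "((\<lambda>w. X (h w)) has_field_derivative X' / h z * h') (at z)"
    by (rule DERIV_chain2[where f = X and g = h, OF X h(1)])
  then have "((\<lambda>w. w) has_field_derivative X' / h z * h') (at z)"
    by (rule has_field_derivative_transform_within_open[OF _ U]) (rule inv)
  then have 1: "X' / h z * h' = 1" using DERIV_ident DERIV_unique by blast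
  then have "X' \<noteq> 0" by auto
  have "F' / h z * h' = F' / X'"
  proof -
    have "F' / h z * h' * X' = F' * (X' / h z * h')" by simp
    also have "\<dots> = F'" by (simp only: 1 mult_1_right)
    finally show ?thesis using \<open>X' \<noteq> 0\<close> by (metis nonzero_eq_divide_eq)
  qed
  moreover have "((\<lambda>w. F (h w)) has_field_derivative F' / h z * h') (at z)"
    by (rule DERIV_chain2[where f = F and g = h, OF F h(1)])
  ultimately show ?thesis by simp
qed

lemma ld_theta_cube_deriv:
  assumes q: "norm q < 1" "q \<noteq> 0"
  shows "((\<lambda>q. ld_theta (q ^ 3)) has_field_derivative
    3 * (ld_theta (q ^ 3) ^ 2
      + theta3 (- (q ^ 3)) ^ 4 * (theta3 (q ^ 3) ^ 4 - theta3 (- (q ^ 3)) ^ 4) / 4) / q) (at q)"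
proof -
  have q3: "norm (q ^ 3) < 1" using q by (simp add: norm_power_less_1)
  have "((\<lambda>q. q ^ 3) has_field_derivative 3 * q ^ 3 / q) (at q)"
    using q(2) by (auto intro!: derivative_eq_intros simp: power3_eq_cube power2_eq_square)
  from holomorphic_chain_on_disc[OF holomorphic_ld_theta q3 this]
  have "((\<lambda>q. ld_theta (q ^ 3)) has_field_derivative 3 * (q ^ 3 * deriv ld_theta (q ^ 3)) / q) (at q)"
    by (simp add: mult_ac)
  then show ?thesis unfolding ld_theta_riccati[OF q3] .
qed

theorem theorem12p2:
  fixes U :: "complex set" and T Q :: "complex \<Rightarrow> complex"
  assumes "local_holomorphic_inverse x_tau upper_half_plane U T"
    and "\<And>x. Q x = Q_tau (T x)"
  shows "Q holomorphic_on U \<and>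
    (\<forall>x\<in>U. deriv (deriv Q) x
        + (1 / x - 1 / (x - 1) + 1 / (x + 1) + 1 / (x - 2) + 1 / (x - 1 / 2)) * deriv Q x
        + 2 * (x ^ 2 - x + 1) / ((x - 1) ^ 2 * (x + 1) * (2 * x - 1)) * Q x = 0)"
proof -
  define h where "h z = exp (of_real pi * \<i> * T z)" for z
  define P where "P z = z * (2 - z) * (z\<^sup>2 - 1) / 2" for z :: complex
  define W where "W z = z\<^sup>2 * (2 - z) * (z + 1) / (2 * (2 * z - 1))" for z :: complex
  define c where "c z = 9 / 4 * (z ^ 3 * (2 - z) * (z - 1) ^ 3 * (z + 1)) / (2 * z - 1)\<^sup>2" for z :: complex
  \<comment> \<open>The logarithmic derivative of \<open>\<theta>\<^sub>3(q\<^sup>3)\<^sup>2\<close>, divided by \<open>\<theta>\<^sub>3(q\<^sup>3)^4\<close>, as a function of \<open>x\<close>.\<close>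
  define t where "t z = 3 * ld_theta (h z ^ 3) / theta3 (h z ^ 3) ^ 4" for z
  from assms(1) have U: "open U" and T: "T holomorphic_on U" and Im: "\<And>z. z \<in> U \<Longrightarrow> Im (T z) > 0"
    and inv: "\<And>z. z \<in> U \<Longrightarrow> x_tau (T z) = z"
    by (auto simp: local_holomorphic_inverse_def upper_half_plane_def)
  have h1: "norm (h z) < 1" if "z \<in> U" for z
    using Im[OF that] by (simp add: h_def norm_exp_eq_Re)
  have h0: "h z \<noteq> 0" for z by (simp add: h_def)
  have hX: "x_nome (h z) = z" if "z \<in> U" for z
    using inv[OF that] by (simp add: eta_quotients_in_nome h_def)
  have hQ: "Q = (\<lambda>z. Q_nome (h z))"
    by (simp add: fun_eq_iff assms(2) eta_quotients_in_nome h_def)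
  have hhol: "h holomorphic_on U"
    unfolding h_def[abs_def] by (intro holomorphic_intros T)
  have hd: "(h has_field_derivative deriv h z) (at z)" if "z \<in> U" for z
    using holomorphic_derivI[OF hhol U that] by simp
  have Qhol: "Q holomorphic_on U"
    unfolding hQ using h1
    by (intro holomorphic_on_compose_gen[OF hhol holomorphic_Q_nome, unfolded o_def]) auto
  \<comment> \<open>The singular points of the equation are not values of \<open>x\<close>, so all divisions below are genuine.\<close>
  have nz: "z \<noteq> 0 \<and> 2 - z \<noteq> 0 \<and> z - 1 \<noteq> 0 \<and> z + 1 \<noteq> 0 \<and> 2 * z - 1 \<noteq> 0" if "z \<in> U" for z
    using theta_quotients_in_x(1-3)[OF h1[OF that] refl] theta_quotient_complements_in_x(3,4)[OF h1[OF that] refl h0]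
    by (simp add: hX[OF that])
  have A0: "theta3 (h z ^ 3) ^ 4 \<noteq> 0" if "z \<in> U" for z
    using theta3_nonzero[OF norm_power_less_1[OF h1[OF that], of 3]] by simp
  have Xd: "(x_nome has_field_derivative P z * theta3 (h z ^ 3) ^ 4 / h z) (at (h z))" if "z \<in> U" for z
  proof -
    have "deriv x_nome (h z) = P z * theta3 (h z ^ 3) ^ 4 / h z"
      using x_nome_deriv_theta(1)[OF h1[OF that] h0 refl] h0[of z]
      by (simp add: hX[OF that] P_def field_simps)
    then show ?thesis using deriv_on_disc[OF holomorphic_x_nome h1[OF that]] by simp
  qed
  have Qd: "(Q has_field_derivative Q z * (t z + W z) / P z) (at z)" if z: "z \<in> U" for z
  proof -
    have "deriv Q_nome (h z) = Q z * (3 * ld_theta (h z ^ 3) + W z * theta3 (h z ^ 3) ^ 4) / h z"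
      using Q_nome_deriv[OF h1[OF z] h0 refl] h0[of z]
      by (simp add: hX[OF z] W_def hQ eq_divide_eq mult.commute)
    then have "(Q_nome has_field_derivative
        Q z * (3 * ld_theta (h z ^ 3) + W z * theta3 (h z ^ 3) ^ 4) / h z) (at (h z))"
      using deriv_on_disc[OF holomorphic_Q_nome h1[OF z]] by simp
    from has_field_derivative_over_inverse[OF this hd[OF z] h0 Xd[OF z] U z hX]
    have "(Q has_field_derivative Q z * (3 * ld_theta (h z ^ 3) + W z * theta3 (h z ^ 3) ^ 4)
        / (P z * theta3 (h z ^ 3) ^ 4)) (at z)"
      unfolding hQ by simp
    moreover have "3 * ld_theta (h z ^ 3) + W z * theta3 (h z ^ 3) ^ 4
        = (t z + W z) * theta3 (h z ^ 3) ^ 4"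
      using A0[OF z] by (simp add: t_def field_simps)
    ultimately show ?thesis using A0[OF z] by simp
  qed
  have td: "(t has_field_derivative (c z - (t z)\<^sup>2) / P z) (at z)" if z: "z \<in> U" for z
  proof -
    define A4 B4 M where "A4 = theta3 (h z ^ 3) ^ 4" and "B4 = theta3 (- (h z ^ 3)) ^ 4"
      and "M = ld_theta (h z ^ 3)"
    note defs = A4_def B4_def M_def
    have A: "A4 \<noteq> 0" using A0[OF z] by (simp add: defs)
    have n: "2 * z - 1 \<noteq> 0" using nz[OF z] by simp
    have "B4 * (2 * z - 1) = A4 * (z ^ 3 * (2 - z))"
      "(A4 - B4) * (2 * z - 1) = A4 * ((z - 1) ^ 3 * (z + 1))"
      using theta_quotients_in_x(4)[OF h1[OF z] refl] theta_quotient_complements_in_x(1)[OF h1[OF z] refl]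
      by (simp_all add: defs hX[OF z])
    then have "(B4 * (A4 - B4)) * (2 * z - 1)\<^sup>2 = A4\<^sup>2 * (z ^ 3 * (2 - z) * (z - 1) ^ 3 * (z + 1))"
      by algebra
    moreover have "c z * (2 * z - 1)\<^sup>2 = 9 / 4 * (z ^ 3 * (2 - z) * (z - 1) ^ 3 * (z + 1))"
      using n by (simp add: c_def)
    ultimately have "(9 / 4 * (B4 * (A4 - B4))) * (2 * z - 1)\<^sup>2 = (c z * A4\<^sup>2) * (2 * z - 1)\<^sup>2"
      by algebra
    then have c: "9 / 4 * (B4 * (A4 - B4)) = c z * A4\<^sup>2"
      using n by simp
    have M: "3 * M = t z * A4" using A by (simp add: t_def defs)
    have "((\<lambda>q. 3 * ld_theta (q ^ 3) / theta3 (q ^ 3) ^ 4) has_field_derivative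
        (3 * (3 * (M\<^sup>2 + B4 * (A4 - B4) / 4) / h z) * A4 - 3 * M * (6 * M * A4 / h z)) / (A4 * A4)) (at (h z))"
      unfolding defs using A0[OF z]
      by (intro DERIV_divide DERIV_cmult ld_theta_cube_deriv theta3_fourth_powers_deriv(3) h1[OF z] h0)
    moreover have "(3 * (3 * (M\<^sup>2 + B4 * (A4 - B4) / 4) / h z) * A4 - 3 * M * (6 * M * A4 / h z)) / (A4 * A4)
        = (c z - (t z)\<^sup>2) * A4 / h z"
    proof -
      have "3 * (3 * (M\<^sup>2 + B4 * (A4 - B4) / 4) / h z) * A4 - 3 * M * (6 * M * A4 / h z)
          = ((3 * M)\<^sup>2 + 9 / 4 * (B4 * (A4 - B4)) - 2 * (3 * M)\<^sup>2) * A4 / h z"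
        using h0[of z] by (simp add: field_simps power2_eq_square)
      also have "\<dots> = (c z - (t z)\<^sup>2) * A4 / h z * (A4 * A4)"
        unfolding M c by (simp add: algebra_simps power2_eq_square diff_divide_distrib)
      finally show ?thesis using A by simp
    qed
    ultimately have "((\<lambda>q. 3 * ld_theta (q ^ 3) / theta3 (q ^ 3) ^ 4) has_field_derivative
        (c z - (t z)\<^sup>2) * A4 / h z) (at (h z))" by simp
    from has_field_derivative_over_inverse[OF this hd[OF z] h0 Xd[OF z] U z hX]
    have "(t has_field_derivative (c z - (t z)\<^sup>2) * A4 / (P z * A4)) (at z)"
      unfolding t_def[abs_def] A4_def by simp
    then show ?thesis using A by simp
  qed
  show ?thesis
    using Qhol riccati_imp_ode[OF U nz Qd[unfolded P_def W_def] td[unfolded P_def c_def]] by blast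
qed

end
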